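(* Let $(R_i)_{i\in S}$ be a family of nonzero commutative rings indexed by a set $S$, and let $R=\prod_{i\in S}R_i$ be their direct product ring. Then the set of tame primes of $R$ is an open subset of $\operatorname{Spec}(R)$, hence an open subscheme of $\operatorname{Spec}(R)$. This scheme is affine if and only if the index set $S$ is finite.
   Context: All rings are commutative with identity. For $k\in S$, $\pi_k:R\to R_k$ denotes the projection map. A tame prime of $R=\prod_{i\in S}R_i$ is a prime ideal of $R$ of the form $\pi_k^{-1}(\mathfrak p)$ for some $k\in S$ and some prime ideal $\mathfrak p$ of $R_k$. An open subset of $\operatorname{Spec}(R)$ is regarded as a scheme with the restricted structure sheaf. *)

theory Defs
  imports "HOL-Algebra.QuotRing" "HOL-Analysis.Abstract_Topology"
begin

section \<open>Product rings and tame primes\<close>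

definition prod_ring :: "'i set \<Rightarrow> ('i \<Rightarrow> ('a, 'm) ring_scheme) \<Rightarrow> ('i \<Rightarrow> 'a) ring" where
  "prod_ring I R =
    \<lparr>carrier = (\<Pi>\<^sub>E i\<in>I. carrier (R i)),
     monoid.mult = (\<lambda>x y. \<lambda>i\<in>I. x i \<otimes>\<^bsub>R i\<^esub> y i),
     one = (\<lambda>i\<in>I. \<one>\<^bsub>R i\<^esub>),
     ring.zero = (\<lambda>i\<in>I. \<zero>\<^bsub>R i\<^esub>),
     ring.add = (\<lambda>x y. \<lambda>i\<in>I. x i \<oplus>\<^bsub>R i\<^esub> y i)\<rparr>"

definition tame_primes :: "'i set \<Rightarrow> ('i \<Rightarrow> ('a, 'm) ring_scheme) \<Rightarrow> ('i \<Rightarrow> 'a) set set" where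
  "tame_primes I R =
    {P. primeideal P (prod_ring I R) \<and>
        (\<exists>k\<in>I. \<exists>p. primeideal p (R k) \<and> P = {x \<in> carrier (prod_ring I R). x k \<in> p})}"

section \<open>Localization at a prime ideal\<close>

text \<open>The fraction \<open>a / s\<close> in the localization of \<open>A\<close> at the prime ideal \<open>P\<close>, as the class of
  all pairs \<open>(b, t)\<close> with \<open>u (a t - b s) = 0\<close> for some \<open>u\<close> outside \<open>P\<close>.\<close>

definition loc_frac :: "('a, 'm) ring_scheme \<Rightarrow> 'a set \<Rightarrow> 'a \<Rightarrow> 'a \<Rightarrow> ('a \<times> 'a) set" where
  "loc_frac A P a s =
    {(b, t). b \<in> carrier A \<and> t \<in> carrier A - P \<and>
       (\<exists>u \<in> carrier A - P. u \<otimes>\<^bsub>A\<^esub> (a \<otimes>\<^bsub>A\<^esub> t \<ominus>\<^bsub>A\<^esub> b \<otimes>\<^bsub>A\<^esub> s) = \<zero>\<^bsub>A\<^esub>)}"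

text \<open>As usual for operations on quotients, the unions below range over all representatives;
  for a prime ideal \<open>P\<close> all the classes joined are equal.\<close>

definition localization :: "('a, 'm) ring_scheme \<Rightarrow> 'a set \<Rightarrow> ('a \<times> 'a) set ring" where
  "localization A P =
    \<lparr>carrier = {loc_frac A P a s |a s. a \<in> carrier A \<and> s \<in> carrier A - P},
     monoid.mult = (\<lambda>X Y. \<Union>{loc_frac A P (a \<otimes>\<^bsub>A\<^esub> b) (s \<otimes>\<^bsub>A\<^esub> t)
                           |a s b t. (a, s) \<in> X \<and> (b, t) \<in> Y}),
     one = loc_frac A P \<one>\<^bsub>A\<^esub> \<one>\<^bsub>A\<^esub>,
     ring.zero = loc_frac A P \<zero>\<^bsub>A\<^esub> \<one>\<^bsub>A\<^esub>,
     ring.add = (\<lambda>X Y. \<Union>{loc_frac A P (a \<otimes>\<^bsub>A\<^esub> t \<oplus>\<^bsub>A\<^esub> b \<otimes>\<^bsub>A\<^esub> s) (s \<otimes>\<^bsub>A\<^esub> t)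
                           |a s b t. (a, s) \<in> X \<and> (b, t) \<in> Y})\<rparr>"

section \<open>Ringed spaces\<close>

text \<open>The data of a presheaf of rings on a topological space; \<open>res X U V\<close> is the restriction
  from \<open>U\<close> to \<open>V\<close>. Only the values on open sets matter.\<close>

record ('p, 's) ringed_space_data =
  space :: "'p topology"
  sections :: "'p set \<Rightarrow> 's ring"
  res :: "'p set \<Rightarrow> 'p set \<Rightarrow> 's \<Rightarrow> 's"

locale ringed_space =
  fixes X :: "('p, 's) ringed_space_data"
  assumes cring_sections: "openin (space X) U \<Longrightarrow> cring (sections X U)"
    and res_hom: "\<lbrakk>openin (space X) U; openin (space X) V; V \<subseteq> U\<rbrakk>
      \<Longrightarrow> res X U V \<in> ring_hom (sections X U) (sections X V)"
    and res_id: "\<lbrakk>openin (space X) U; s \<in> carrier (sections X U)\<rbrakk> \<Longrightarrow> res X U U s = s"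
    and res_res: "\<lbrakk>openin (space X) U; openin (space X) V; openin (space X) W; W \<subseteq> V; V \<subseteq> U;
        s \<in> carrier (sections X U)\<rbrakk> \<Longrightarrow> res X V W (res X U V s) = res X U W s"
    and glue: "\<lbrakk>\<And>U. U \<in> \<U> \<Longrightarrow> openin (space X) U;
        \<And>U. U \<in> \<U> \<Longrightarrow> t U \<in> carrier (sections X U);
        \<And>U V. \<lbrakk>U \<in> \<U>; V \<in> \<U>\<rbrakk> \<Longrightarrow> res X U (U \<inter> V) (t U) = res X V (U \<inter> V) (t V)\<rbrakk>
      \<Longrightarrow> \<exists>!s\<in>carrier (sections X (\<Union>\<U>)). \<forall>U\<in>\<U>. res X (\<Union>\<U>) U s = t U"

text \<open>For open \<open>U\<close>, the ringed space with underlying space \<open>U\<close> and the restricted sheaf.\<close>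

definition open_subspace ::
    "('p, 's) ringed_space_data \<Rightarrow> 'p set \<Rightarrow> ('p, 's) ringed_space_data" where
  "open_subspace X U = X\<lparr>space := subtopology (space X) U\<rparr>"

text \<open>An isomorphism consists of a homeomorphism \<open>f\<close> and an isomorphism \<open>\<phi>\<close> from the sheaf
  of \<open>Y\<close> to the direct image of the sheaf of \<open>X\<close>. Between locally ringed spaces such a pair
  automatically induces local homomorphisms on stalks.\<close>

definition isomorphic_ringed_spaces ::
    "('p, 's) ringed_space_data \<Rightarrow> ('q, 't) ringed_space_data \<Rightarrow> bool" where
  "isomorphic_ringed_spaces X Y \<longleftrightarrow>
    (\<exists>f \<phi>. homeomorphic_map (space X) (space Y) f \<and>
      (let pre = (\<lambda>V. {x \<in> topspace (space X). f x \<in> V}) in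
        (\<forall>V. openin (space Y) V \<longrightarrow> \<phi> V \<in> ring_iso (sections Y V) (sections X (pre V))) \<and>
        (\<forall>V W. openin (space Y) V \<longrightarrow> openin (space Y) W \<longrightarrow> W \<subseteq> V \<longrightarrow>
          (\<forall>s\<in>carrier (sections Y V).
             \<phi> W (res Y V W s) = res X (pre V) (pre W) (\<phi> V s)))))"

section \<open>The spectrum of a commutative ring\<close>

definition zariski_open :: "('a, 'm) ring_scheme \<Rightarrow> 'a set set \<Rightarrow> bool" where
  "zariski_open A U \<longleftrightarrow> (\<exists>E \<subseteq> carrier A. U = {P. primeideal P A \<and> \<not> E \<subseteq> P})"

definition zariski :: "('a, 'm) ring_scheme \<Rightarrow> 'a set topology" where
  "zariski A = topology (zariski_open A)"

lemma istopology_zariski_open: "istopology (zariski_open A)"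
  unfolding istopology_def
proof (intro conjI allI impI)
  fix U V assume "zariski_open A U" "zariski_open A V"
  then obtain E F where E: "E \<subseteq> carrier A" "U = {P. primeideal P A \<and> \<not> E \<subseteq> P}"
    and F: "F \<subseteq> carrier A" "V = {P. primeideal P A \<and> \<not> F \<subseteq> P}"
    unfolding zariski_open_def by blast
  let ?G = "{a \<otimes>\<^bsub>A\<^esub> b |a b. a \<in> E \<and> b \<in> F}"
  have iff: "\<not> ?G \<subseteq> P \<longleftrightarrow> \<not> E \<subseteq> P \<and> \<not> F \<subseteq> P" if "primeideal P A" for P
  proof -
    interpret primeideal P A by fact
    show ?thesis
    proof
      assume "\<not> ?G \<subseteq> P"
      then obtain a b where "a \<in> E" "b \<in> F" "a \<otimes>\<^bsub>A\<^esub> b \<notin> P" by blast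
      then show "\<not> E \<subseteq> P \<and> \<not> F \<subseteq> P"
        using E(1) F(1) I_l_closed I_r_closed by blast
    next
      assume "\<not> E \<subseteq> P \<and> \<not> F \<subseteq> P"
      then obtain a b where ab: "a \<in> E" "a \<notin> P" "b \<in> F" "b \<notin> P" by blast
      then have "a \<otimes>\<^bsub>A\<^esub> b \<notin> P" using I_prime E(1) F(1) by blast
      then show "\<not> ?G \<subseteq> P" using ab by blast
    qed
  qed
  have "?G \<subseteq> carrier A" if "primeideal P A" for P
  proof -
    interpret primeideal P A by fact
    show ?thesis using E(1) F(1) by auto
  qed
  then show "zariski_open A (U \<inter> V)"
  proof (cases "\<exists>P. primeideal P A")
    case True
    then have "?G \<subseteq> carrier A" using \<open>\<And>P. primeideal P A \<Longrightarrow> ?G \<subseteq> carrier A\<close> by blast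
    moreover have "U \<inter> V = {P. primeideal P A \<and> \<not> ?G \<subseteq> P}"
      unfolding E(2) F(2) using iff by blast
    ultimately show ?thesis unfolding zariski_open_def by blast
  next
    case False
    then have "U \<inter> V = {P. primeideal P A \<and> \<not> E \<subseteq> P}" using E(2) by blast
    then show ?thesis using E(1) unfolding zariski_open_def by blast
  qed
next
  fix \<K> assume "\<forall>K\<in>\<K>. zariski_open A K"
  then obtain E where E: "\<And>K. K \<in> \<K> \<Longrightarrow> E K \<subseteq> carrier A \<and> K = {P. primeideal P A \<and> \<not> E K \<subseteq> P}"
    unfolding zariski_open_def by metis
  then have "(\<Union>K\<in>\<K>. E K) \<subseteq> carrier A" by blast
  moreover have "\<Union>\<K> = {P. primeideal P A \<and> \<not> (\<Union>K\<in>\<K>. E K) \<subseteq> P}"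
    using E by blast
  ultimately show "zariski_open A (\<Union>\<K>)"
    unfolding zariski_open_def by blast
qed

lemma openin_zariski [simp]: "openin (zariski A) U \<longleftrightarrow> zariski_open A U"
  unfolding zariski_def by (simp add: istopology_zariski_open)

text \<open>A section over \<open>U\<close> assigns to each \<open>P \<in> U\<close> an element of the localization at \<open>P\<close>
  and is locally given by a single fraction \<open>a / g\<close>; the operations are pointwise.\<close>

definition spec_sections ::
    "('a, 'm) ring_scheme \<Rightarrow> 'a set set \<Rightarrow> ('a set \<Rightarrow> ('a \<times> 'a) set) ring" where
  "spec_sections A U =
    (prod_ring U (localization A))
      \<lparr>carrier := {s \<in> carrier (prod_ring U (localization A)).
         \<forall>P\<in>U. \<exists>V. openin (zariski A) V \<and> P \<in> V \<and> V \<subseteq> U \<and>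
           (\<exists>a\<in>carrier A. \<exists>g\<in>carrier A. \<forall>Q\<in>V. g \<notin> Q \<and> s Q = loc_frac A Q a g)}\<rparr>"

definition Spec ::
    "('a, 'm) ring_scheme \<Rightarrow> ('a set, 'a set \<Rightarrow> ('a \<times> 'a) set) ringed_space_data" where
  "Spec A = \<lparr>space = zariski A, sections = spec_sections A, res = (\<lambda>U V s. restrict s V)\<rparr>"

section \<open>Schemes\<close>

text \<open>These are the definitions of EGA I: an affine scheme is a ringed space isomorphic to the
  spectrum of a ring, a scheme is a ringed space in which every point has an affine open
  neighbourhood. HOL cannot quantify over all types inside a formula, so the type in which the
  coordinate rings are sought is an explicit parameter.\<close>

definition affine_scheme :: "'c itself \<Rightarrow> ('p, 's) ringed_space_data \<Rightarrow> bool" where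
  "affine_scheme T X \<longleftrightarrow>
    ringed_space X \<and> (\<exists>A :: 'c ring. cring A \<and> isomorphic_ringed_spaces X (Spec A))"

definition scheme :: "'c itself \<Rightarrow> ('p, 's) ringed_space_data \<Rightarrow> bool" where
  "scheme T X \<longleftrightarrow>
    ringed_space X \<and>
    (\<forall>x\<in>topspace (space X). \<exists>U. openin (space X) U \<and> x \<in> U \<and> affine_scheme T (open_subspace X U))"

text \<open>The set of tame primes with the restricted structure sheaf.\<close>

definition tame_scheme :: "'i set \<Rightarrow> ('i \<Rightarrow> ('a, 'm) ring_scheme) \<Rightarrow>
    (('i \<Rightarrow> 'a) set, ('i \<Rightarrow> 'a) set \<Rightarrow> (('i \<Rightarrow> 'a) \<times> ('i \<Rightarrow> 'a)) set) ringed_space_data" where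
  "tame_scheme I R = open_subspace (Spec (prod_ring I R)) (tame_primes I R)"

end

theory Submission
  imports Defs "HOL-Algebra.Ring_Divisibility" "HOL-Algebra.Subrings"
begin

text \<open>
  Let \<open>e\<^sub>k\<close> be the idempotent of \<open>R\<close> that is \<open>1\<close> at \<open>k\<close> and \<open>0\<close> elsewhere. A prime is tame iff it
  avoids some \<open>e\<^sub>k\<close>, so the tame primes form the union of the basic open sets \<open>D(e\<^sub>k)\<close>. For an
  idempotent \<open>e\<close> of a ring \<open>A\<close>, the open subscheme \<open>D(e)\<close> is isomorphic to \<open>Spec (e A)\<close>; taking
  \<open>e = e\<^sub>k\<close> gives an affine open cover of the tame primes. If \<open>S\<close> is finite, the \<open>e\<^sub>k\<close> add up to \<open>1\<close>,
  so all primes are tame, and \<open>e = 1\<close> gives affineness. Conversely an affine scheme is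
  quasi-compact, whereas the \<open>D(e\<^sub>k)\<close> are disjoint and, the factors being nonzero, nonempty.
\<close>

section \<open>Prime ideals\<close>

text \<open>Affineness is relative to a type for the coordinate ring, which shapes both directions.
  Positive claims need an actual ring over \<open>'i \<Rightarrow> 'a\<close>. Therefore
  \<open>D(e\<^sub>k)\<close> is compared with the subset \<open>e\<^sub>k R\<close> of the product
  and not with \<open>R k\<close>, whose elements have another type. The negative claim has to
  exclude every type; quasi-compactness achieves this because it depends on the underlying space
  alone.

  Most of the work is the isomorphism of \<open>D(e)\<close> with the spectrum of
  \<open>e A\<close>. It rests on one fact: since \<open>e (1 - e) = 0\<close>, the element
  \<open>e\<close> becomes 1 in the localization at any prime avoiding \<open>e\<close>, so
  \<open>a / g\<close> equals \<open>(e a) / (e g)\<close>, a fraction over \<open>e A\<close>.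
  Conversely a fraction over \<open>e A\<close> can be read as a fraction over \<open>A\<close>
  without change. Sections are functions that are locally fractions, so both translations carry over
  from localizations to sections.\<close>

lemma (in cring) primeidealI_closed:
  assumes "P \<subseteq> carrier R" "\<zero> \<in> P" "\<one> \<notin> P"
    and add: "\<And>x y. \<lbrakk>x \<in> P; y \<in> P\<rbrakk> \<Longrightarrow> x \<oplus> y \<in> P"
    and mult: "\<And>x y. \<lbrakk>x \<in> carrier R; y \<in> P\<rbrakk> \<Longrightarrow> x \<otimes> y \<in> P"
    and prime: "\<And>x y. \<lbrakk>x \<in> carrier R; y \<in> carrier R; x \<otimes> y \<in> P\<rbrakk> \<Longrightarrow> x \<in> P \<or> y \<in> P"
  shows "primeideal P R"
proof (rule primeidealI2)
  \<comment> \<open>Closure under negation is not assumed; it is multiplication by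
    \<open>\<ominus> \<one>\<close>.\<close>
  have "\<ominus> x \<in> P" if "x \<in> P" for x
    using mult[of "\<ominus> \<one>" x] that assms(1) by (simp add: l_minus subset_iff)
  then show "additive_subgroup P R"
    using assms(1,2) add by (intro additive_subgroup.intro add.subgroupI) (auto simp: a_inv_def)
  show "a \<otimes> x \<in> P" if "a \<in> P" "x \<in> carrier R" for a x
    using mult[OF that(2,1)] that assms(1) by (simp add: m_comm subset_iff)
qed (use assms is_cring in auto)

context primeideal
begin

lemma one_notin: "\<one> \<notin> I"
  using I_notcarr one_imp_carrier by blast

lemma mult_notin: "s \<in> carrier R - I \<Longrightarrow> t \<in> carrier R - I \<Longrightarrow> s \<otimes> t \<in> carrier R - I"
  using I_prime by blast

end

text \<open>Zorn's lemma is applied to the ideals above \<open>J\<close> that avoid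
  \<open>\<one>\<close>. An ideal containing \<open>\<one>\<close> is the whole ring, so a maximal
  member is a maximal ideal, hence prime.\<close>

lemma (in cring) prime_avoiding_one:
  assumes "ideal J R" "\<one> \<notin> J"
  obtains P where "primeideal P R" "J \<subseteq> P"
proof -
  define \<A> where "\<A> = {K. ideal K R \<and> J \<subseteq> K \<and> \<one> \<notin> K}"
  have "\<Union>C \<in> \<A>" if "C \<noteq> {}" "subset.chain \<A> C" for C
  proof -
    have "subset.chain {I. ideal I R} C" "C \<subseteq> \<A>"
      using that(2) by (auto simp: subset.chain_def \<A>_def)
    then show ?thesis
      using chain_Union_is_ideal[of C] that(1) by (auto simp: \<A>_def)
  qed
  moreover have "J \<in> \<A>"
    using assms by (simp add: \<A>_def)
  ultimately obtain M where M: "M \<in> \<A>" "\<And>K. K \<in> \<A> \<Longrightarrow> M \<subseteq> K \<Longrightarrow> K = M"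
    using subset_Zorn_nonempty[of \<A>] by blast
  have "maximalideal M R"
  proof (rule maximalidealI)
    show "ideal M R" "carrier R \<noteq> M"
      using M(1) by (auto simp: \<A>_def)
    fix K assume K: "ideal K R" "M \<subseteq> K"
    then show "K = M \<or> K = carrier R"
      using M(1) M(2)[of K] ideal.one_imp_carrier[OF K(1)] by (auto simp: \<A>_def)
  qed
  then show ?thesis
    using that maximalideal_prime M(1) by (auto simp: \<A>_def)
qed

section \<open>Product rings\<close>

lemma prod_ring_simps [simp]:
  "carrier (prod_ring I R) = (\<Pi>\<^sub>E i\<in>I. carrier (R i))"
  "x \<otimes>\<^bsub>prod_ring I R\<^esub> y = (\<lambda>i\<in>I. x i \<otimes>\<^bsub>R i\<^esub> y i)"
  "x \<oplus>\<^bsub>prod_ring I R\<^esub> y = (\<lambda>i\<in>I. x i \<oplus>\<^bsub>R i\<^esub> y i)"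
  "\<one>\<^bsub>prod_ring I R\<^esub> = (\<lambda>i\<in>I. \<one>\<^bsub>R i\<^esub>)"
  "\<zero>\<^bsub>prod_ring I R\<^esub> = (\<lambda>i\<in>I. \<zero>\<^bsub>R i\<^esub>)"
  by (auto simp: prod_ring_def)

lemma cring_prod_ring:
  assumes "\<And>i. i \<in> I \<Longrightarrow> cring (R i)"
  shows "cring (prod_ring I R)"
proof -
  note rules = cring.cring_simprules[OF assms]
  note [simp] = rules(1,2,5,6)
  show ?thesis
  proof (rule cringI)
    show "abelian_group (prod_ring I R)"
    proof (rule abelian_groupI)
      fix x assume x: "x \<in> carrier (prod_ring I R)"
      then have "(\<lambda>i\<in>I. \<ominus>\<^bsub>R i\<^esub> x i) \<in> carrier (prod_ring I R)"
        using rules by auto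
      moreover have "(\<lambda>i\<in>I. \<ominus>\<^bsub>R i\<^esub> x i) \<oplus>\<^bsub>prod_ring I R\<^esub> x = \<zero>\<^bsub>prod_ring I R\<^esub>"
        using x rules(9) by (auto simp: fun_eq_iff PiE_iff)
      ultimately show "\<exists>y\<in>carrier (prod_ring I R). y \<oplus>\<^bsub>prod_ring I R\<^esub> x = \<zero>\<^bsub>prod_ring I R\<^esub>"
        by blast
      \<comment> \<open>The right-hand side is \<open>x\<close> itself and not a restriction, so
        extensionality of \<open>x\<close> enters.\<close>
      show "\<zero>\<^bsub>prod_ring I R\<^esub> \<oplus>\<^bsub>prod_ring I R\<^esub> x = x"
        using x rules(8) by (intro ext) (auto simp: PiE_iff extensional_def)
    qed (use rules in \<open>auto simp: fun_eq_iff PiE_iff\<close>)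
    show "comm_monoid (prod_ring I R)"
      by (rule comm_monoidI)
        (use rules in \<open>auto simp: fun_eq_iff PiE_iff extensional_def\<close>)
  qed (use rules in \<open>auto simp: fun_eq_iff PiE_iff\<close>)
qed

section \<open>Localization\<close>

context primeideal
begin

text \<open>The difference in \<open>loc_frac\<close> is traded for an equation between products,
  which can be treated by commutative normalization.\<close>

lemma loc_frac_iff:
  assumes "a \<in> carrier R" "s \<in> carrier R"
  shows "(b, t) \<in> loc_frac R I a s \<longleftrightarrow> b \<in> carrier R \<and> t \<in> carrier R - I \<and>
    (\<exists>u\<in>carrier R - I. u \<otimes> (a \<otimes> t) = u \<otimes> (b \<otimes> s))"
proof -
  have "u \<otimes> (a \<otimes> t \<ominus> b \<otimes> s) = \<zero> \<longleftrightarrow> u \<otimes> (a \<otimes> t) = u \<otimes> (b \<otimes> s)"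
    if "u \<in> carrier R" "b \<in> carrier R" "t \<in> carrier R" for u
    using that assms r_right_minus_eq[of "u \<otimes> (a \<otimes> t)" "u \<otimes> (b \<otimes> s)"]
    by (simp add: r_distr minus_eq r_minus)
  then show ?thesis
    unfolding loc_frac_def by auto
qed

lemma mem_loc_frac: "a \<in> carrier R \<Longrightarrow> s \<in> carrier R - I \<Longrightarrow> (a, s) \<in> loc_frac R I a s"
  using one_notin by (auto simp: loc_frac_iff)

text \<open>The hypothesis is symmetric in the two fractions, so one inclusion, proved for arbitrary
  fractions, is used twice.\<close>

lemma loc_frac_eqI:
  assumes "a \<in> carrier R" "s \<in> carrier R - I" "b \<in> carrier R" "t \<in> carrier R - I"
    and u: "u \<in> carrier R - I" "u \<otimes> (a \<otimes> t) = u \<otimes> (b \<otimes> s)"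
  shows "loc_frac R I a s = loc_frac R I b t"
proof -
  have sub: "loc_frac R I a s \<subseteq> loc_frac R I b t"
    if fr: "a \<in> carrier R" "s \<in> carrier R - I" "b \<in> carrier R" "t \<in> carrier R - I"
      "u \<otimes> (a \<otimes> t) = u \<otimes> (b \<otimes> s)" for a s b t
  proof (clarify)
    fix c v assume "(c, v) \<in> loc_frac R I a s"
    then obtain w where w: "c \<in> carrier R" "v \<in> carrier R - I" "w \<in> carrier R - I"
      "w \<otimes> (a \<otimes> v) = w \<otimes> (c \<otimes> s)"
      using fr by (auto simp: loc_frac_iff)
    \<comment> \<open>From \<open>u a t = u b s\<close> and \<open>w a v = w c s\<close> the
      denominator \<open>s\<close> cannot be cancelled, so it joins the multiplier:
      \<open>u w s\<close> equates \<open>b v\<close> with \<open>c t\<close>.\<close>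
    have "(u \<otimes> w \<otimes> s) \<otimes> (b \<otimes> v) = (u \<otimes> (b \<otimes> s)) \<otimes> (w \<otimes> v)"
      using fr(1-4) w(1-3) u(1) by (simp add: m_ac)
    also have "\<dots> = (w \<otimes> (a \<otimes> v)) \<otimes> (u \<otimes> t)"
      unfolding fr(5)[symmetric] using fr(1-4) w(1-3) u(1) by (simp add: m_ac)
    also have "\<dots> = (u \<otimes> w \<otimes> s) \<otimes> (c \<otimes> t)"
      unfolding w(4) using fr(1-4) w(1-3) u(1) by (simp add: m_ac)
    finally have "(u \<otimes> w \<otimes> s) \<otimes> (b \<otimes> v) = (u \<otimes> w \<otimes> s) \<otimes> (c \<otimes> t)" .
    moreover have "u \<otimes> w \<otimes> s \<in> carrier R - I"
      using fr(2) w(3) u(1) by (intro mult_notin)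
    ultimately show "(c, v) \<in> loc_frac R I b t"
      using fr(3,4) w(1,2) loc_frac_iff[of b t c v] by blast
  qed
  show ?thesis
    using sub[OF assms(1-4) u(2)] sub[OF assms(3,4,1,2) u(2)[symmetric]] by (rule equalityI)
qed

lemma loc_frac_cancel:
  assumes "a \<in> carrier R" "s \<in> carrier R - I" "u \<in> carrier R - I"
  shows "loc_frac R I (u \<otimes> a) (u \<otimes> s) = loc_frac R I a s"
  using assms one_notin by (intro loc_frac_eqI[where u = \<one>] mult_notin m_closed) (simp_all add: m_ac)

abbreviation "L \<equiv> localization R I"

lemma localization_carrierE:
  assumes "x \<in> carrier L"
  obtains a s where "a \<in> carrier R" "s \<in> carrier R - I" "x = loc_frac R I a s"
  using assms by (auto simp: localization_def)

lemma loc_frac_in_carrier [simp]: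
  "a \<in> carrier R \<Longrightarrow> s \<in> carrier R \<Longrightarrow> s \<notin> I \<Longrightarrow> loc_frac R I a s \<in> carrier L"
  by (auto simp: localization_def)

lemma localization_one: "\<one>\<^bsub>L\<^esub> = loc_frac R I \<one> \<one>"
  and localization_zero: "\<zero>\<^bsub>L\<^esub> = loc_frac R I \<zero> \<one>"
  by (auto simp: localization_def)

text \<open>Well-definedness: all representatives give the same class, with the product of the two
  multipliers as the new multiplier. The union in the definition therefore runs over a singleton;
  \<open>mem_loc_frac\<close> shows that it is not empty.\<close>

lemma localization_mult:
  assumes "a \<in> carrier R" "s \<in> carrier R" "s \<notin> I" "b \<in> carrier R" "t \<in> carrier R" "t \<notin> I"
  shows "loc_frac R I a s \<otimes>\<^bsub>L\<^esub> loc_frac R I b t = loc_frac R I (a \<otimes> b) (s \<otimes> t)"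
proof -
  have "loc_frac R I (c \<otimes> d) (v \<otimes> w) = loc_frac R I (a \<otimes> b) (s \<otimes> t)"
    if fr: "(c, v) \<in> loc_frac R I a s" "(d, w) \<in> loc_frac R I b t" for c v d w
  proof -
    obtain x y where *: "c \<in> carrier R" "v \<in> carrier R - I" "d \<in> carrier R" "w \<in> carrier R - I"
      "x \<in> carrier R - I" "x \<otimes> (a \<otimes> v) = x \<otimes> (c \<otimes> s)"
      "y \<in> carrier R - I" "y \<otimes> (b \<otimes> w) = y \<otimes> (d \<otimes> t)"
      using fr assms by (auto simp: loc_frac_iff)
    have "(x \<otimes> y) \<otimes> ((c \<otimes> d) \<otimes> (s \<otimes> t)) = (x \<otimes> (c \<otimes> s)) \<otimes> (y \<otimes> (d \<otimes> t))"
      using *(1-5,7) assms by (simp add: m_ac)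
    also have "\<dots> = (x \<otimes> y) \<otimes> ((a \<otimes> b) \<otimes> (v \<otimes> w))"
      unfolding *(6,8)[symmetric] using *(1-5,7) assms by (simp add: m_ac)
    finally show ?thesis
      using *(1-5,7) assms by (intro loc_frac_eqI[where u = "x \<otimes> y"] mult_notin m_closed a_closed) simp_all
  qed
  then have "{loc_frac R I (c \<otimes> d) (v \<otimes> w) |c v d w.
      (c, v) \<in> loc_frac R I a s \<and> (d, w) \<in> loc_frac R I b t} = {loc_frac R I (a \<otimes> b) (s \<otimes> t)}"
    using assms mem_loc_frac[of a s] mem_loc_frac[of b t] by blast
  then show ?thesis
    by (simp add: localization_def)
qed

text \<open>The argument is that for products; each summand uses one of the two multiplier
  equations.\<close>

lemma localization_add:
  assumes "a \<in> carrier R" "s \<in> carrier R" "s \<notin> I" "b \<in> carrier R" "t \<in> carrier R" "t \<notin> I"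
  shows "loc_frac R I a s \<oplus>\<^bsub>L\<^esub> loc_frac R I b t = loc_frac R I (a \<otimes> t \<oplus> b \<otimes> s) (s \<otimes> t)"
proof -
  have "loc_frac R I (c \<otimes> w \<oplus> d \<otimes> v) (v \<otimes> w) = loc_frac R I (a \<otimes> t \<oplus> b \<otimes> s) (s \<otimes> t)"
    if fr: "(c, v) \<in> loc_frac R I a s" "(d, w) \<in> loc_frac R I b t" for c v d w
  proof -
    obtain x y where *: "c \<in> carrier R" "v \<in> carrier R - I" "d \<in> carrier R" "w \<in> carrier R - I"
      "x \<in> carrier R - I" "x \<otimes> (a \<otimes> v) = x \<otimes> (c \<otimes> s)"
      "y \<in> carrier R - I" "y \<otimes> (b \<otimes> w) = y \<otimes> (d \<otimes> t)"
      using fr assms by (auto simp: loc_frac_iff)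
    have "(x \<otimes> y) \<otimes> ((c \<otimes> w \<oplus> d \<otimes> v) \<otimes> (s \<otimes> t)) =
        (x \<otimes> (c \<otimes> s)) \<otimes> (y \<otimes> w \<otimes> t) \<oplus> (y \<otimes> (d \<otimes> t)) \<otimes> (x \<otimes> v \<otimes> s)"
      using *(1-5,7) assms by (simp add: m_ac l_distr r_distr)
    also have "\<dots> = (x \<otimes> y) \<otimes> ((a \<otimes> t \<oplus> b \<otimes> s) \<otimes> (v \<otimes> w))"
      unfolding *(6,8)[symmetric] using *(1-5,7) assms by (simp add: m_ac l_distr r_distr)
    finally show ?thesis
      using *(1-5,7) assms by (intro loc_frac_eqI[where u = "x \<otimes> y"] mult_notin m_closed a_closed) simp_all
  qed
  then have "{loc_frac R I (c \<otimes> w \<oplus> d \<otimes> v) (v \<otimes> w) |c v d w.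
      (c, v) \<in> loc_frac R I a s \<and> (d, w) \<in> loc_frac R I b t} =
      {loc_frac R I (a \<otimes> t \<oplus> b \<otimes> s) (s \<otimes> t)}"
    using assms mem_loc_frac[of a s] mem_loc_frac[of b t] by blast
  then show ?thesis
    by (simp add: localization_def)
qed

text \<open>The general formula has denominator \<open>s \<otimes> s\<close>, and one factor
  cancels.\<close>

lemma localization_add_same_denom:
  assumes "a \<in> carrier R" "b \<in> carrier R" "s \<in> carrier R" "s \<notin> I"
  shows "loc_frac R I a s \<oplus>\<^bsub>L\<^esub> loc_frac R I b s = loc_frac R I (a \<oplus> b) s"
  using assms loc_frac_cancel[of "a \<oplus> b" s s]
  by (simp add: localization_add r_distr m_comm)

lemma loc_frac_zero:
  assumes "s \<in> carrier R" "s \<notin> I"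
  shows "loc_frac R I \<zero> s = \<zero>\<^bsub>L\<^esub>"
  using assms loc_frac_cancel[of \<zero> \<one> s] one_notin by (simp add: localization_zero)

lemma cring_localization: "cring L"
proof (rule cringI)
  note [simp] = localization_one localization_zero localization_mult localization_add
    one_notin mult_notin[simplified]
  show "abelian_group L"
  proof (rule abelian_groupI)
    fix x assume "x \<in> carrier L"
    then obtain a s where x: "a \<in> carrier R" "s \<in> carrier R - I" "x = loc_frac R I a s"
      by (rule localization_carrierE)
    then show "\<zero>\<^bsub>L\<^esub> \<oplus>\<^bsub>L\<^esub> x = x"
      by simp
    have "loc_frac R I (\<ominus> a) s \<oplus>\<^bsub>L\<^esub> x = \<zero>\<^bsub>L\<^esub>"
      using x loc_frac_zero[of s]
      by (simp add: localization_add_same_denom l_neg del: localization_add localization_zero)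
    then show "\<exists>y\<in>carrier L. y \<oplus>\<^bsub>L\<^esub> x = \<zero>\<^bsub>L\<^esub>"
      using x by (intro bexI[of _ "loc_frac R I (\<ominus> a) s"]) auto
  next
    fix x y z assume "x \<in> carrier L" "y \<in> carrier L" "z \<in> carrier L"
    then show "x \<oplus>\<^bsub>L\<^esub> y \<oplus>\<^bsub>L\<^esub> z = x \<oplus>\<^bsub>L\<^esub> (y \<oplus>\<^bsub>L\<^esub> z)"
      by (elim localization_carrierE) (simp add: l_distr r_distr m_ac a_ac)
  qed (auto elim!: localization_carrierE simp: m_comm a_comm)
  show "comm_monoid L"
    by (rule comm_monoidI) (auto elim!: localization_carrierE simp: m_ac)
next
  fix x y z assume "x \<in> carrier L" "y \<in> carrier L" "z \<in> carrier L"
  then obtain a s b t c v where *: "a \<in> carrier R" "s \<in> carrier R - I" "x = loc_frac R I a s"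
    "b \<in> carrier R" "t \<in> carrier R - I" "y = loc_frac R I b t"
    "c \<in> carrier R" "v \<in> carrier R - I" "z = loc_frac R I c v"
    by (elim localization_carrierE) blast
  \<comment> \<open>The other side of the distributive law has denominator
    \<open>(s \<otimes> v) \<otimes> (t \<otimes> v)\<close>, so this fraction is expanded by
    \<open>v\<close> to match it.\<close>
  have "(x \<oplus>\<^bsub>L\<^esub> y) \<otimes>\<^bsub>L\<^esub> z = loc_frac R I (v \<otimes> ((a \<otimes> t \<oplus> b \<otimes> s) \<otimes> c)) (v \<otimes> (s \<otimes> t \<otimes> v))"
    using * mult_notin by (simp add: localization_mult localization_add loc_frac_cancel)
  also have "\<dots> = x \<otimes>\<^bsub>L\<^esub> z \<oplus>\<^bsub>L\<^esub> y \<otimes>\<^bsub>L\<^esub> z"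
    using * mult_notin by (simp add: localization_mult localization_add l_distr r_distr m_ac)
  finally show "(x \<oplus>\<^bsub>L\<^esub> y) \<otimes>\<^bsub>L\<^esub> z = x \<otimes>\<^bsub>L\<^esub> z \<oplus>\<^bsub>L\<^esub> y \<otimes>\<^bsub>L\<^esub> z" .
qed

end

section \<open>The structure sheaf of a spectrum\<close>

lemma openin_zariski_prime: "openin (zariski A) U \<Longrightarrow> P \<in> U \<Longrightarrow> primeideal P A"
  by (auto simp: zariski_open_def)

text \<open>No prime contains the whole carrier, so \<open>E = carrier A\<close> exhibits the set of
  all primes as open.\<close>

lemma topspace_zariski: "topspace (zariski A) = {P. primeideal P A}"
proof -
  have "\<not> carrier A \<subseteq> P" if "primeideal P A" for P
    using primeideal.I_notcarr[OF that] ideal.Icarr[OF primeideal.axioms(1)[OF that]] by blast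
  then have "openin (zariski A) {P. primeideal P A}"
    unfolding openin_zariski zariski_open_def by blast
  then show ?thesis
    using openin_zariski_prime[of A] openin_subset openin_topspace by blast
qed

text \<open>This is the local condition inside \<open>spec_sections\<close>, isolated so that
  neighbourhoods can be handled apart from membership in the product of localizations.\<close>

definition locally_fraction ::
    "('a, 'm) ring_scheme \<Rightarrow> 'a set set \<Rightarrow> ('a set \<Rightarrow> ('a \<times> 'a) set) \<Rightarrow> bool" where
  "locally_fraction A U s \<longleftrightarrow> (\<forall>P\<in>U. \<exists>V. openin (zariski A) V \<and> P \<in> V \<and> V \<subseteq> U \<and>
     (\<exists>a\<in>carrier A. \<exists>g\<in>carrier A. \<forall>Q\<in>V. g \<notin> Q \<and> s Q = loc_frac A Q a g))"

lemma locally_fractionE: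
  assumes "locally_fraction A U s" "P \<in> U"
  obtains V a g where "openin (zariski A) V" "P \<in> V" "V \<subseteq> U" "a \<in> carrier A" "g \<in> carrier A"
    "\<forall>Q\<in>V. g \<notin> Q \<and> s Q = loc_frac A Q a g"
proof -
  obtain V where V: "openin (zariski A) V" "P \<in> V" "V \<subseteq> U"
    "\<exists>a\<in>carrier A. \<exists>g\<in>carrier A. \<forall>Q\<in>V. g \<notin> Q \<and> s Q = loc_frac A Q a g"
    using bspec[OF assms(1)[unfolded locally_fraction_def] assms(2)] by (elim exE conjE)
  from V(4) obtain a g where ag: "a \<in> carrier A" "g \<in> carrier A"
    "\<forall>Q\<in>V. g \<notin> Q \<and> s Q = loc_frac A Q a g"
    by (elim bexE)
  show ?thesis
    by (rule that[of V a g]) (use V(1-3) ag in simp_all)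
qed

lemma locally_fractionI:
  assumes "\<And>P. P \<in> U \<Longrightarrow> \<exists>V a g. openin (zariski A) V \<and> P \<in> V \<and> V \<subseteq> U \<and>
    a \<in> carrier A \<and> g \<in> carrier A \<and> (\<forall>Q\<in>V. g \<notin> Q \<and> s Q = loc_frac A Q a g)"
  shows "locally_fraction A U s"
  unfolding locally_fraction_def using assms by meson

text \<open>Agreement of \<open>s'\<close> with \<open>s\<close> is asked on \<open>V\<close> only,
  so that \<open>s'\<close> can be \<open>restrict s V\<close>.\<close>

lemma locally_fraction_mono:
  assumes "locally_fraction A U s" "openin (zariski A) V" "V \<subseteq> U"
    "\<And>P. P \<in> V \<Longrightarrow> s' P = s P"
  shows "locally_fraction A V s'"
proof (rule locally_fractionI)
  fix P assume "P \<in> V"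
  with assms(3) have "P \<in> U"
    by blast
  with assms(1) obtain W a g
    where "openin (zariski A) W" "P \<in> W" "W \<subseteq> U" "a \<in> carrier A" "g \<in> carrier A"
    "\<forall>Q\<in>W. g \<notin> Q \<and> s Q = loc_frac A Q a g"
    by (rule locally_fractionE)
  then have "openin (zariski A) (V \<inter> W) \<and> P \<in> V \<inter> W \<and> V \<inter> W \<subseteq> V \<and>
      a \<in> carrier A \<and> g \<in> carrier A \<and> (\<forall>Q\<in>V \<inter> W. g \<notin> Q \<and> s' Q = loc_frac A Q a g)"
    using \<open>P \<in> V\<close> assms(4) openin_Int[OF assms(2), of W] by (simp del: openin_zariski)
  then show "\<exists>V' a g. openin (zariski A) V' \<and> P \<in> V' \<and> V' \<subseteq> V \<and>
      a \<in> carrier A \<and> g \<in> carrier A \<and> (\<forall>Q\<in>V'. g \<notin> Q \<and> s' Q = loc_frac A Q a g)"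
    by (intro exI)
qed

lemma carrier_spec_sections:
  "carrier (spec_sections A U) =
    {s \<in> (\<Pi>\<^sub>E P\<in>U. carrier (localization A P)). locally_fraction A U s}"
  by (simp add: spec_sections_def locally_fraction_def)

lemma spec_sections_simps [simp]:
  "x \<otimes>\<^bsub>spec_sections A U\<^esub> y = (\<lambda>P\<in>U. x P \<otimes>\<^bsub>localization A P\<^esub> y P)"
  "x \<oplus>\<^bsub>spec_sections A U\<^esub> y = (\<lambda>P\<in>U. x P \<oplus>\<^bsub>localization A P\<^esub> y P)"
  "\<one>\<^bsub>spec_sections A U\<^esub> = (\<lambda>P\<in>U. \<one>\<^bsub>localization A P\<^esub>)"
  "\<zero>\<^bsub>spec_sections A U\<^esub> = (\<lambda>P\<in>U. \<zero>\<^bsub>localization A P\<^esub>)"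
  by (auto simp: spec_sections_def prod_ring_def)

text \<open>A local fraction with denominator outside \<open>P\<close> already forces the value at
  \<open>P\<close> into the localization.\<close>

lemma spec_sectionsI:
  assumes "openin (zariski A) U" "s \<in> extensional U" "locally_fraction A U s"
  shows "s \<in> carrier (spec_sections A U)"
proof -
  have "s P \<in> carrier (localization A P)" if P: "P \<in> U" for P
  proof -
    obtain V a g where "openin (zariski A) V" "P \<in> V" "V \<subseteq> U" "a \<in> carrier A" "g \<in> carrier A"
      "\<forall>Q\<in>V. g \<notin> Q \<and> s Q = loc_frac A Q a g"
      by (rule locally_fractionE[OF assms(3) P])
    then show ?thesis
      using primeideal.loc_frac_in_carrier[OF openin_zariski_prime[OF assms(1) P], of a g] by simp
  qed
  then show ?thesis
    using assms(2,3) by (auto simp: carrier_spec_sections PiE_iff)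
qed

text \<open>\<open>f\<close> and \<open>k\<close> give numerator and denominator of the result in
  terms of those of the operands; they are valid on the intersection of the two
  neighbourhoods.\<close>

lemma locally_fraction_binary:
  assumes s: "locally_fraction A U s" and t: "locally_fraction A U t"
    and r: "\<And>P a g b h. \<lbrakk>P \<in> U; a \<in> carrier A; g \<in> carrier A - P; b \<in> carrier A; h \<in> carrier A - P;
        s P = loc_frac A P a g; t P = loc_frac A P b h\<rbrakk> \<Longrightarrow>
      f a g b h \<in> carrier A \<and> k g h \<in> carrier A - P \<and> r P = loc_frac A P (f a g b h) (k g h)"
  shows "locally_fraction A U r"
proof (rule locally_fractionI)
  fix P assume P: "P \<in> U"
  obtain V a g where V: "openin (zariski A) V" "P \<in> V" "V \<subseteq> U" "a \<in> carrier A" "g \<in> carrier A"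
    "\<forall>Q\<in>V. g \<notin> Q \<and> s Q = loc_frac A Q a g"
    by (rule locally_fractionE[OF s P])
  obtain W b h where W: "openin (zariski A) W" "P \<in> W" "W \<subseteq> U" "b \<in> carrier A" "h \<in> carrier A"
    "\<forall>Q\<in>W. h \<notin> Q \<and> t Q = loc_frac A Q b h"
    by (rule locally_fractionE[OF t P])
  have *: "f a g b h \<in> carrier A \<and> k g h \<in> carrier A - Q \<and> r Q = loc_frac A Q (f a g b h) (k g h)"
    if "Q \<in> V \<inter> W" for Q
    using that V(3-) W(3-) by (intro r) auto
  show "\<exists>V a g. openin (zariski A) V \<and> P \<in> V \<and> V \<subseteq> U \<and>
      a \<in> carrier A \<and> g \<in> carrier A \<and> (\<forall>Q\<in>V. g \<notin> Q \<and> r Q = loc_frac A Q a g)"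
  proof (intro exI conjI ballI)
    show "openin (zariski A) (V \<inter> W)"
      using V(1) W(1) by (rule openin_Int)
    show "f a g b h \<in> carrier A" "k g h \<in> carrier A"
      using *[of P] V(2) W(2) by auto
    show "k g h \<notin> Q" "r Q = loc_frac A Q (f a g b h) (k g h)" if "Q \<in> V \<inter> W" for Q
      using *[OF that] by auto
  qed (use V W in auto)
qed

lemma locally_fraction_const:
  assumes "openin (zariski A) U" "a \<in> carrier A" "g \<in> carrier A"
    "\<And>P. P \<in> U \<Longrightarrow> g \<notin> P \<and> s P = loc_frac A P a g"
  shows "locally_fraction A U s"
  unfolding locally_fraction_def using assms by blast

context cring
begin

text \<open>The sections form a subring of the product of the localizations, because the fraction
  formulas for the operations use one numerator and one denominator on a whole
  neighbourhood.\<close>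

lemma cring_spec_sections:
  assumes U: "openin (zariski R) U"
  shows "cring (spec_sections R U)"
proof -
  let ?L = "localization R"
  let ?\<Pi> = "prod_ring U ?L"
  let ?H = "{s \<in> (\<Pi>\<^sub>E P\<in>U. carrier (?L P)). locally_fraction R U s}"
  have prime: "primeideal P R" if "P \<in> U" for P
    using openin_zariski_prime[OF U that] .
  have loc: "cring (?L P)" if "P \<in> U" for P
    using primeideal.cring_localization[OF prime[OF that]] .
  interpret prod: cring ?\<Pi>
    by (rule cring_prod_ring) (rule loc)
  have "subring ?H ?\<Pi>"
  proof (rule prod.subringI)
    show "?H \<subseteq> carrier ?\<Pi>"
      by auto
    have "locally_fraction R U \<one>\<^bsub>?\<Pi>\<^esub>"
      by (rule locally_fraction_const[OF U, where a = \<one> and g = \<one>])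
        (use primeideal.one_notin[OF prime] primeideal.localization_one[OF prime] in simp_all)
    then show "\<one>\<^bsub>?\<Pi>\<^esub> \<in> ?H"
      using prod.one_closed by simp
  next
    fix s assume s: "s \<in> ?H"
    have "locally_fraction R U (\<ominus>\<^bsub>?\<Pi>\<^esub> s)"
    \<comment> \<open>The second operand is ignored, so the binary lemma serves a unary
      operation.\<close>
    proof (rule locally_fraction_binary[where f = "\<lambda>a g b h. \<ominus> a" and k = "\<lambda>g h. g"])
      fix P a g assume P: "P \<in> U" and ag: "a \<in> carrier R" "g \<in> carrier R - P" "s P = loc_frac R P a g"
      interpret P: primeideal P R
        using prime[OF P] .
      interpret LP: cring "?L P"
        using loc[OF P] .
      \<comment> \<open>Negation in the product ring is given only abstractly; uniqueness of
        additive inverses in the localization identifies its value at \<open>P\<close>.\<close>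
      have "(\<ominus>\<^bsub>?\<Pi>\<^esub> s) P \<oplus>\<^bsub>?L P\<^esub> s P = (\<ominus>\<^bsub>?\<Pi>\<^esub> s \<oplus>\<^bsub>?\<Pi>\<^esub> s) P"
        using P by simp
      also have "\<dots> = \<zero>\<^bsub>?L P\<^esub>"
        using P s prod.l_neg[of s] by simp
      finally have "\<ominus>\<^bsub>?L P\<^esub> s P = (\<ominus>\<^bsub>?\<Pi>\<^esub> s) P"
        using P s prod.a_inv_closed[of s] by (intro LP.minus_equality) auto
      moreover have "\<ominus>\<^bsub>?L P\<^esub> s P = loc_frac R P (\<ominus> a) g"
        using ag P.loc_frac_zero[of g]
        by (intro LP.minus_equality) (auto simp: P.localization_add_same_denom l_neg)
      ultimately show "\<ominus> a \<in> carrier R \<and> g \<in> carrier R - P \<and>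
          (\<ominus>\<^bsub>?\<Pi>\<^esub> s) P = loc_frac R P (\<ominus> a) g"
        using ag by simp
    qed (use s in auto)
    then show "\<ominus>\<^bsub>?\<Pi>\<^esub> s \<in> ?H"
      using prod.a_inv_closed[of s] s by simp
  next
    fix s t assume st: "s \<in> ?H" "t \<in> ?H"
    have "locally_fraction R U (s \<otimes>\<^bsub>?\<Pi>\<^esub> t)"
      by (rule locally_fraction_binary[where s = s and t = t and f = "\<lambda>a g b h. a \<otimes> b"
            and k = "\<lambda>g h. g \<otimes> h"])
        (use st primeideal.mult_notin[OF prime] primeideal.localization_mult[OF prime] in simp_all)
    then show "s \<otimes>\<^bsub>?\<Pi>\<^esub> t \<in> ?H"
      using prod.m_closed[of s t] st by simp
    have "locally_fraction R U (s \<oplus>\<^bsub>?\<Pi>\<^esub> t)"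
      by (rule locally_fraction_binary[where s = s and t = t
            and f = "\<lambda>a g b h. a \<otimes> h \<oplus> b \<otimes> g" and k = "\<lambda>g h. g \<otimes> h"])
        (use st primeideal.mult_notin[OF prime] primeideal.localization_add[OF prime] in simp_all)
    then show "s \<oplus>\<^bsub>?\<Pi>\<^esub> t \<in> ?H"
      using prod.a_closed[of s t] st by simp
  qed
  then have "subcring ?H ?\<Pi>"
    by (rule prod.subcringI')
  moreover have "spec_sections R U = ?\<Pi>\<lparr>carrier := ?H\<rparr>"
    by (simp add: spec_sections_def locally_fraction_def)
  ultimately show ?thesis
    using prod.subcring_iff[of ?H] by auto
qed

text \<open>Sections are genuine functions subject to a local condition, so they restrict as
  functions and are glued point by point.\<close>

lemma ringed_space_Spec: "ringed_space (Spec R)"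
proof (rule ringed_space.intro)
  note [simp] = Spec_def
  note [simp del] = openin_zariski
  show "cring (sections (Spec R) U)" if "openin (space (Spec R)) U" for U
    using that cring_spec_sections by simp
  show "res (Spec R) U V \<in> ring_hom (sections (Spec R) U) (sections (Spec R) V)"
    if "openin (space (Spec R)) U" "openin (space (Spec R)) V" "V \<subseteq> U" for U V
  proof (rule ring_hom_memI)
    fix s assume s: "s \<in> carrier (sections (Spec R) U)"
    then have "locally_fraction R V (restrict s V)"
      using that(2,3) by (intro locally_fraction_mono[of R U s V]) (auto simp: carrier_spec_sections)
    then show "res (Spec R) U V s \<in> carrier (sections (Spec R) V)"
      using s that(3) by (auto simp: carrier_spec_sections PiE_iff)
  qed (use that(3) in \<open>auto simp: fun_eq_iff\<close>)
  show "res (Spec R) U U s = s" if "s \<in> carrier (sections (Spec R) U)" for U s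
    using that by (auto simp: carrier_spec_sections PiE_iff extensional_restrict)
  show "res (Spec R) V W (res (Spec R) U V s) = res (Spec R) U W s" if "W \<subseteq> V" for U V W s
    using that by (auto simp: fun_eq_iff)
next
  fix \<U> t
  assume op: "\<And>U. U \<in> \<U> \<Longrightarrow> openin (space (Spec R)) U"
    and t: "\<And>U. U \<in> \<U> \<Longrightarrow> t U \<in> carrier (sections (Spec R) U)"
    and agree: "\<And>U V. \<lbrakk>U \<in> \<U>; V \<in> \<U>\<rbrakk> \<Longrightarrow>
      res (Spec R) U (U \<inter> V) (t U) = res (Spec R) V (U \<inter> V) (t V)"
  \<comment> \<open>Any member of the cover through \<open>P\<close> may be chosen: agreement on
    overlaps makes the value independent of the choice.\<close>
  define s where "s = (\<lambda>P\<in>\<Union>\<U>. t (SOME U. U \<in> \<U> \<and> P \<in> U) P)"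
  have s: "s P = t U P" if "U \<in> \<U>" "P \<in> U" for U P
  proof -
    define V where "V = (SOME U. U \<in> \<U> \<and> P \<in> U)"
    have V: "V \<in> \<U>" "P \<in> V"
      using someI[of "\<lambda>U. U \<in> \<U> \<and> P \<in> U" U] that by (auto simp: V_def)
    have "s P = t V P"
      using that by (auto simp: s_def V_def)
    also have "\<dots> = t U P"
      using fun_cong[OF agree[OF that(1) V(1)], of P] that V by (simp add: Spec_def)
    finally show ?thesis .
  qed
  have "locally_fraction R (\<Union>\<U>) s"
  proof (rule locally_fractionI)
    fix P assume "P \<in> \<Union>\<U>"
    then obtain U where U: "U \<in> \<U>" "P \<in> U" by blast
    then have "locally_fraction R U (t U)"
      using t[OF U(1)] by (simp add: Spec_def carrier_spec_sections)
    then obtain V a g where "openin (zariski R) V" "P \<in> V" "V \<subseteq> U" "a \<in> carrier R" "g \<in> carrier R"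
      "\<forall>Q\<in>V. g \<notin> Q \<and> t U Q = loc_frac R Q a g"
      by (rule locally_fractionE[OF _ U(2)])
    then have "openin (zariski R) V \<and> P \<in> V \<and> V \<subseteq> \<Union>\<U> \<and>
        a \<in> carrier R \<and> g \<in> carrier R \<and> (\<forall>Q\<in>V. g \<notin> Q \<and> s Q = loc_frac R Q a g)"
      using U s[OF U(1)] by (auto simp del: openin_zariski)
    then show "\<exists>V a g. openin (zariski R) V \<and> P \<in> V \<and> V \<subseteq> \<Union>\<U> \<and>
        a \<in> carrier R \<and> g \<in> carrier R \<and> (\<forall>Q\<in>V. g \<notin> Q \<and> s Q = loc_frac R Q a g)"
      by (intro exI)
  qed
  moreover have "openin (zariski R) (\<Union>\<U>)"
    using op by (intro openin_Union) (auto simp: Spec_def simp del: openin_zariski)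
  ultimately have "s \<in> carrier (sections (Spec R) (\<Union>\<U>))"
    by (auto simp: Spec_def s_def intro!: spec_sectionsI simp del: openin_zariski)
  moreover have "\<forall>U\<in>\<U>. res (Spec R) (\<Union>\<U>) U s = t U"
  proof
    fix U assume U: "U \<in> \<U>"
    then have "t U \<in> extensional U"
      using t[OF U] by (auto simp: Spec_def carrier_spec_sections PiE_iff)
    then show "res (Spec R) (\<Union>\<U>) U s = t U"
      using s[OF U] by (auto simp: Spec_def fun_eq_iff extensional_def)
  qed
  moreover have "s' = s" if "s' \<in> carrier (sections (Spec R) (\<Union>\<U>))"
    "\<forall>U\<in>\<U>. res (Spec R) (\<Union>\<U>) U s' = t U" for s'
  proof (rule extensionalityI[of _ "\<Union>\<U>"])
    show "s' \<in> extensional (\<Union>\<U>)" "s \<in> extensional (\<Union>\<U>)"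
      using that(1) by (auto simp: Spec_def carrier_spec_sections PiE_iff s_def)
    fix P assume "P \<in> \<Union>\<U>"
    then obtain U where U: "U \<in> \<U>" "P \<in> U" by blast
    then have "restrict s' U = t U"
      using that(2) by (simp add: Spec_def)
    then show "s' P = s P"
      using s[OF U] U(2) by (metis restrict_apply')
  qed
  ultimately show "\<exists>!s\<in>carrier (sections (Spec R) (\<Union>\<U>)). \<forall>U\<in>\<U>. res (Spec R) (\<Union>\<U>) U s = t U"
    by blast
qed

end

text \<open>The opens of the subspace are the opens of \<open>X\<close> inside \<open>U\<close>,
  while sections and restrictions are kept, so each axiom is an instance of the one for
  \<open>X\<close>.\<close>

lemma ringed_space_open_subspace:
  assumes X: "ringed_space X" and U: "openin (space X) U"
  shows "ringed_space (open_subspace X U)"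
proof -
  interpret ringed_space X by fact
  have op: "openin (space (open_subspace X U)) V \<longleftrightarrow> openin (space X) V \<and> V \<subseteq> U" for V
    using openin_open_subtopology[OF U] by (simp add: open_subspace_def)
  have [simp]: "sections (open_subspace X U) = sections X" "res (open_subspace X U) = res X"
    by (simp_all add: open_subspace_def)
  show ?thesis
  proof (rule ringed_space.intro)
    fix \<U> t
    assume "\<And>V. V \<in> \<U> \<Longrightarrow> openin (space (open_subspace X U)) V"
      and "\<And>V. V \<in> \<U> \<Longrightarrow> t V \<in> carrier (sections (open_subspace X U) V)"
      and "\<And>V W. \<lbrakk>V \<in> \<U>; W \<in> \<U>\<rbrakk> \<Longrightarrow>
        res (open_subspace X U) V (V \<inter> W) (t V) = res (open_subspace X U) W (V \<inter> W) (t W)"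
    then have "\<exists>!s\<in>carrier (sections X (\<Union>\<U>)). \<forall>V\<in>\<U>. res X (\<Union>\<U>) V s = t V"
      unfolding op by (intro glue) simp_all
    then show "\<exists>!s\<in>carrier (sections (open_subspace X U) (\<Union>\<U>)).
        \<forall>V\<in>\<U>. res (open_subspace X U) (\<Union>\<U>) V s = t V"
      by simp
  qed (simp_all add: op cring_sections res_hom res_id res_res)
qed

section \<open>The open subscheme defined by an idempotent\<close>

text \<open>The localization of \<open>A\<close> at an idempotent \<open>e\<close> is \<open>e A\<close> with unit \<open>e\<close>; this model has
  the element type of \<open>A\<close>, as the type parameter of \<^const>\<open>scheme\<close> requires.\<close>

definition corner_ring :: "('a, 'm) ring_scheme \<Rightarrow> 'a \<Rightarrow> 'a ring" where
  "corner_ring A e =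
    \<lparr>carrier = {x \<in> carrier A. e \<otimes>\<^bsub>A\<^esub> x = x}, monoid.mult = (\<otimes>\<^bsub>A\<^esub>), one = e,
     ring.zero = \<zero>\<^bsub>A\<^esub>, ring.add = (\<oplus>\<^bsub>A\<^esub>)\<rparr>"

locale idempotent = cring +
  fixes e
  assumes e_closed [simp]: "e \<in> carrier R"
    and e_idem [simp]: "e \<otimes> e = e"
begin

section \<open>Arithmetic and prime ideals of the corner ring\<close>

abbreviation "B \<equiv> corner_ring R e"

lemma corner_simps [simp]:
  "x \<in> carrier B \<longleftrightarrow> x \<in> carrier R \<and> e \<otimes> x = x"
  "x \<otimes>\<^bsub>B\<^esub> y = x \<otimes> y" "x \<oplus>\<^bsub>B\<^esub> y = x \<oplus> y" "\<one>\<^bsub>B\<^esub> = e" "\<zero>\<^bsub>B\<^esub> = \<zero>"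
  by (simp_all add: corner_ring_def)

lemma e_absorb [simp]: "x \<in> carrier R \<Longrightarrow> e \<otimes> (e \<otimes> x) = e \<otimes> x"
  by (simp flip: m_assoc)

lemma e_mult: "x \<in> carrier R \<Longrightarrow> y \<in> carrier R \<Longrightarrow> e \<otimes> (x \<otimes> y) = (e \<otimes> x) \<otimes> (e \<otimes> y)"
  by (simp add: m_ac)

lemma e_prod:
  assumes "x \<in> carrier R" "y \<in> carrier R" "e \<otimes> x = x"
  shows "e \<otimes> (x \<otimes> y) = x \<otimes> y"
  using assms m_assoc[of e x y] by simp

lemma cring_corner: "cring B"
proof (rule cringI)
  show "abelian_group B"
  proof (rule abelian_groupI)
    fix x assume "x \<in> carrier B"
    then show "\<exists>y\<in>carrier B. y \<oplus>\<^bsub>B\<^esub> x = \<zero>\<^bsub>B\<^esub>"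
      by (intro bexI[of _ "\<ominus> x"]) (simp_all add: l_neg r_minus)
  qed (simp_all add: r_distr a_ac)
  show "comm_monoid B"
    by (rule comm_monoidI) (simp_all add: e_prod m_assoc, simp_all add: m_comm)
qed (simp add: l_distr)

text \<open>As \<open>e\<close> is the unit of \<open>B\<close>, the condition
  \<open>e \<notin> P\<close> is what keeps the contracted ideal proper.\<close>

lemma primeideal_corner:
  assumes "primeideal P R" "e \<notin> P"
  shows "primeideal (P \<inter> carrier B) B"
proof -
  interpret P: primeideal P R by fact
  show ?thesis
  proof (rule cring.primeidealI_closed[OF cring_corner])
    fix x y assume "x \<in> carrier B" "y \<in> carrier B" "x \<otimes>\<^bsub>B\<^esub> y \<in> P \<inter> carrier B"
    then show "x \<in> P \<inter> carrier B \<or> y \<in> P \<inter> carrier B"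
      using P.I_prime[of x y] by simp
  qed (use assms(2) in \<open>auto simp: r_distr P.I_l_closed e_prod\<close>)
qed

text \<open>The candidate is the preimage of \<open>Q\<close> under multiplication by
  \<open>e\<close>, a ring homomorphism onto \<open>B\<close>.\<close>

lemma primeideal_lift:
  assumes "primeideal Q B"
  shows "primeideal {x \<in> carrier R. e \<otimes> x \<in> Q} R" "e \<notin> {x \<in> carrier R. e \<otimes> x \<in> Q}"
proof -
  interpret Q: primeideal Q B by fact
  show "primeideal {x \<in> carrier R. e \<otimes> x \<in> Q} R"
  proof (rule primeidealI_closed)
    fix x y assume "x \<in> carrier R" "y \<in> {x \<in> carrier R. e \<otimes> x \<in> Q}"
    then show "x \<otimes> y \<in> {x \<in> carrier R. e \<otimes> x \<in> Q}"
      using Q.I_l_closed[of "e \<otimes> y" "e \<otimes> x"] by (simp add: e_mult[of x y])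
  next
    fix x y assume "x \<in> carrier R" "y \<in> carrier R" "x \<otimes> y \<in> {x \<in> carrier R. e \<otimes> x \<in> Q}"
    then show "x \<in> {x \<in> carrier R. e \<otimes> x \<in> Q} \<or> y \<in> {x \<in> carrier R. e \<otimes> x \<in> Q}"
      using Q.I_prime[of "e \<otimes> x" "e \<otimes> y"] by (simp add: e_mult[of x y])
  next
    fix x y assume "x \<in> {x \<in> carrier R. e \<otimes> x \<in> Q}" "y \<in> {x \<in> carrier R. e \<otimes> x \<in> Q}"
    then show "x \<oplus> y \<in> {x \<in> carrier R. e \<otimes> x \<in> Q}"
      using additive_subgroup.a_closed[OF Q.additive_subgroup_axioms, of "e \<otimes> x" "e \<otimes> y"] by (simp add: r_distr)
  qed (use Q.one_notin additive_subgroup.zero_closed[OF Q.additive_subgroup_axioms] in simp_all)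
  show "e \<notin> {x \<in> carrier R. e \<otimes> x \<in> Q}"
    using Q.one_notin by simp
qed

lemma e_mult_mem_iff:
  assumes "primeideal P R" "e \<notin> P" "x \<in> carrier R"
  shows "e \<otimes> x \<in> P \<longleftrightarrow> x \<in> P"
proof -
  interpret P: primeideal P R by fact
  show ?thesis
    using P.I_l_closed[of x e] P.I_prime[of e x] assms(2,3) by auto
qed

text \<open>By primality, whether \<open>x\<close> lies in \<open>P\<close> depends only on
  \<open>e \<otimes> x\<close>, so a prime avoiding \<open>e\<close> is recovered from its part
  inside \<open>B\<close>.\<close>

lemma lift_corner:
  assumes "primeideal P R" "e \<notin> P"
  shows "{x \<in> carrier R. e \<otimes> x \<in> P \<inter> carrier B} = P"
  using e_mult_mem_iff[OF assms] ideal.Icarr[OF primeideal.axioms(1)[OF assms(1)]] by auto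

lemma corner_lift: "primeideal Q B \<Longrightarrow> {x \<in> carrier R. e \<otimes> x \<in> Q} \<inter> carrier B = Q"
  using ideal.Icarr[OF primeideal.axioms(1), of Q B] by auto

section \<open>The homeomorphism from \<open>D(e)\<close> to the spectrum of the corner ring\<close>

abbreviation "D \<equiv> {P. primeideal P R \<and> e \<notin> P}"

lemma openin_D: "openin (zariski R) D"
  unfolding openin_zariski zariski_open_def by (rule exI[of _ "{e}"]) auto

lemma topspace_D: "topspace (subtopology (zariski R) D) = D"
  using openin_subset[OF openin_D] by (simp add: topspace_subtopology Int_absorb1)

text \<open>The set \<open>E\<close> defining \<open>V\<close> also defines the preimage. The
  condition \<open>e \<notin> P\<close> is then automatic: every element of \<open>E\<close> is a
  multiple of \<open>e\<close>, so \<open>e \<in> P\<close> would give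
  \<open>E \<subseteq> P\<close>.\<close>

lemma openin_corner_vimage:
  assumes "openin (zariski B) V"
  shows "openin (zariski R) {P \<in> D. P \<inter> carrier B \<in> V}"
proof -
  obtain E where E: "E \<subseteq> carrier B" "V = {Q. primeideal Q B \<and> \<not> E \<subseteq> Q}"
    using assms by (auto simp: zariski_open_def)
  have "e \<notin> P" if "primeideal P R" "\<not> E \<subseteq> P" for P
  proof
    assume "e \<in> P"
    interpret P: primeideal P R by fact
    have "x \<in> P" if "x \<in> E" for x
    proof -
      have "x \<in> carrier B"
        using E(1) that by blast
      then show ?thesis
        using P.I_r_closed[OF \<open>e \<in> P\<close>, of x] by simp
    qed
    then show False
      using that(2) by blast
  qed
  then have "{P \<in> D. P \<inter> carrier B \<in> V} = {P. primeideal P R \<and> \<not> E \<subseteq> P}"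
    using primeideal_corner E by blast
  moreover have "E \<subseteq> carrier R"
    using E(1) by auto
  ultimately show ?thesis
    unfolding openin_zariski zariski_open_def by blast
qed

text \<open>The lifted prime contains \<open>E\<close> iff \<open>Q\<close> contains the multiples
  \<open>e \<otimes> x\<close> with \<open>x \<in> E\<close>, so these define the preimage.\<close>

lemma openin_lift_vimage:
  assumes "openin (zariski R) W"
  shows "openin (zariski B) {Q. primeideal Q B \<and> {x \<in> carrier R. e \<otimes> x \<in> Q} \<in> W}"
proof -
  obtain E where E: "E \<subseteq> carrier R" "W = {P. primeideal P R \<and> \<not> E \<subseteq> P}"
    using assms by (auto simp: zariski_open_def)
  have "{Q. primeideal Q B \<and> {x \<in> carrier R. e \<otimes> x \<in> Q} \<in> W} =
      {Q. primeideal Q B \<and> \<not> (\<otimes>) e ` E \<subseteq> Q}"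
    using primeideal_lift E by blast
  moreover have "(\<otimes>) e ` E \<subseteq> carrier B"
    using E(1) by auto
  ultimately show ?thesis
    unfolding openin_zariski zariski_open_def by blast
qed

lemma homeomorphic_map_corner:
  "homeomorphic_map (subtopology (zariski R) D) (zariski B) (\<lambda>P. P \<inter> carrier B)"
  unfolding homeomorphic_map_maps
proof (intro exI)
  show "homeomorphic_maps (subtopology (zariski R) D) (zariski B) (\<lambda>P. P \<inter> carrier B)
      (\<lambda>Q. {x \<in> carrier R. e \<otimes> x \<in> Q})"
    unfolding homeomorphic_maps_def
  proof (intro conjI ballI)
    show "continuous_map (subtopology (zariski R) D) (zariski B) (\<lambda>P. P \<inter> carrier B)"
      unfolding continuous_map topspace_D openin_open_subtopology[OF openin_D]
      using openin_corner_vimage primeideal_corner by (auto simp: topspace_zariski simp del: openin_zariski)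
    show "continuous_map (zariski B) (subtopology (zariski R) D) (\<lambda>Q. {x \<in> carrier R. e \<otimes> x \<in> Q})"
      unfolding continuous_map topspace_D openin_open_subtopology[OF openin_D]
      using openin_lift_vimage primeideal_lift by (auto simp: topspace_zariski simp del: openin_zariski)
  qed (use lift_corner corner_lift in \<open>simp_all add: topspace_D topspace_zariski\<close>)
qed

text \<open>As fractions are classes of pairs, the isomorphism from the localization of \<open>e A\<close> at
  \<open>P \<inter> e A\<close> to that of \<open>A\<close> at \<open>P\<close> is a preimage under multiplication by \<open>e\<close>, and its inverse is
  intersection with \<open>e A \<times> e A\<close>.\<close>

definition loc_lift :: "('a \<times> 'a) set \<Rightarrow> ('a \<times> 'a) set" where
  "loc_lift X = {(b, t). b \<in> carrier R \<and> t \<in> carrier R \<and> (e \<otimes> b, e \<otimes> t) \<in> X}"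

text \<open>A multiplier \<open>u\<close> from \<open>B\<close> serves over \<open>R\<close>
  unchanged, since \<open>e \<otimes> u = u\<close>. A multiplier from \<open>R\<close> is replaced
  by \<open>e \<otimes> u\<close>, which stays outside \<open>P\<close> by primality. Denominators
  match by \<open>e_mult_mem_iff\<close>.\<close>

lemma loc_lift_frac:
  assumes P: "primeideal P R" "e \<notin> P" and a: "a \<in> carrier B" and g: "g \<in> carrier B" "g \<notin> P"
  shows "loc_lift (loc_frac B (P \<inter> carrier B) a g) = loc_frac R P a g"
proof -
  interpret P: primeideal P R by fact
  interpret Q: primeideal "P \<inter> carrier B" B
    by (rule primeideal_corner[OF P])
  have aR: "a \<in> carrier R" and gR: "g \<in> carrier R"
    using a g by simp_all
  have key: "(\<exists>u\<in>carrier B - P \<inter> carrier B. u \<otimes> (a \<otimes> (e \<otimes> t)) = u \<otimes> (e \<otimes> b \<otimes> g)) \<longleftrightarrow>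
      (\<exists>u\<in>carrier R - P. u \<otimes> (a \<otimes> t) = u \<otimes> (b \<otimes> g))" (is "?l \<longleftrightarrow> ?r")
    if bt: "b \<in> carrier R" "t \<in> carrier R" for b t
  proof
    have move: "u \<otimes> (a \<otimes> (e \<otimes> t)) = e \<otimes> (u \<otimes> (a \<otimes> t))" "u \<otimes> (e \<otimes> b \<otimes> g) = e \<otimes> (u \<otimes> (b \<otimes> g))"
      if "u \<in> carrier R" for u
      using that bt aR gR by (simp_all add: m_ac)
    show ?r if l: ?l
    proof -
      from l obtain u where "u \<in> carrier B - P \<inter> carrier B"
        "u \<otimes> (a \<otimes> (e \<otimes> t)) = u \<otimes> (e \<otimes> b \<otimes> g)"
        by blast
      then have u: "u \<in> carrier R" "e \<otimes> u = u" "u \<notin> P"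
        "e \<otimes> (u \<otimes> (a \<otimes> t)) = e \<otimes> (u \<otimes> (b \<otimes> g))"
        by (auto simp flip: move)
      have "u \<otimes> (a \<otimes> t) = u \<otimes> (b \<otimes> g)"
        using u(4) u(1) bt aR gR e_prod[OF _ _ u(2)] by simp
      then show ?r
        using u(1,3) by blast
    qed
    show ?l if r: ?r
    proof -
      from r obtain u where u: "u \<in> carrier R - P" "u \<otimes> (a \<otimes> t) = u \<otimes> (b \<otimes> g)"
        by blast
      have "(e \<otimes> u) \<otimes> (a \<otimes> (e \<otimes> t)) = e \<otimes> (e \<otimes> (u \<otimes> (a \<otimes> t)))"
        using u(1) bt aR by (simp add: m_ac)
      also have "\<dots> = (e \<otimes> u) \<otimes> (e \<otimes> b \<otimes> g)"
        unfolding u(2) using u(1) bt gR by (simp add: m_ac)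
      finally show ?l
        using u(1) P.mult_notin[of e u] P(2) by (intro bexI[of _ "e \<otimes> u"]) auto
    qed
  qed
  have "(b, t) \<in> loc_lift (loc_frac B (P \<inter> carrier B) a g) \<longleftrightarrow> (b, t) \<in> loc_frac R P a g" for b t
  proof (cases "b \<in> carrier R \<and> t \<in> carrier R")
    case True
    then show ?thesis
      using key[of b t] Q.loc_frac_iff[OF a g(1), of "e \<otimes> b" "e \<otimes> t"]
        P.loc_frac_iff[OF aR gR, of b t] e_mult_mem_iff[OF P, of t]
      by (simp add: loc_lift_def)
  qed (auto simp: loc_lift_def P.loc_frac_iff[OF aR gR])
  then show ?thesis
    by auto
qed

text \<open>On \<open>B\<close> multiplication by \<open>e\<close> is the identity. The resulting
  left inverse of \<open>loc_lift\<close> yields injectivity.\<close>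

lemma loc_lift_inter: "X \<subseteq> carrier B \<times> carrier B \<Longrightarrow> loc_lift X \<inter> carrier B \<times> carrier B = X"
  by (force simp: loc_lift_def)

text \<open>As \<open>e\<close> lies outside \<open>P\<close>, the fraction may be expanded by
  \<open>e\<close>; numerator and denominator then lie in \<open>B\<close>, where
  \<open>loc_lift_frac\<close> applies.\<close>

lemma loc_frac_corner:
  assumes "primeideal P R" "e \<notin> P" "a \<in> carrier R" "g \<in> carrier R" "g \<notin> P"
  shows "loc_frac R P a g \<inter> carrier B \<times> carrier B = loc_frac B (P \<inter> carrier B) (e \<otimes> a) (e \<otimes> g)"
    and "e \<otimes> g \<notin> P"
    and "loc_lift (loc_frac R P a g \<inter> carrier B \<times> carrier B) = loc_frac R P a g"
proof -
  interpret P: primeideal P R by fact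
  show "e \<otimes> g \<notin> P"
    using P.I_prime[of e g] assms by auto
  then have *: "loc_lift (loc_frac B (P \<inter> carrier B) (e \<otimes> a) (e \<otimes> g)) = loc_frac R P a g"
    using assms P.loc_frac_cancel[of a g e] by (subst loc_lift_frac) auto
  have "loc_frac B (P \<inter> carrier B) (e \<otimes> a) (e \<otimes> g) \<subseteq> carrier B \<times> carrier B"
    by (auto simp: loc_frac_def)
  then show "loc_frac R P a g \<inter> carrier B \<times> carrier B = loc_frac B (P \<inter> carrier B) (e \<otimes> a) (e \<otimes> g)"
    using loc_lift_inter by (simp flip: *)
  then show "loc_lift (loc_frac R P a g \<inter> carrier B \<times> carrier B) = loc_frac R P a g"
    using * by simp
qed

lemma loc_lift_iso:
  assumes P: "primeideal P R" "e \<notin> P"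
  shows "loc_lift \<in> ring_iso (localization B (P \<inter> carrier B)) (localization R P)"
proof -
  interpret P: primeideal P R by fact
  interpret Q: primeideal "P \<inter> carrier B" B
    by (rule primeideal_corner[OF P])
  have Q_carrierE: thesis if "x \<in> carrier Q.L"
    "\<And>a g. \<lbrakk>a \<in> carrier B; g \<in> carrier B; g \<notin> P; x = loc_frac B (P \<inter> carrier B) a g\<rbrakk> \<Longrightarrow> thesis" for x thesis
    using that by (elim Q.localization_carrierE) auto
  have sub: "x \<subseteq> carrier B \<times> carrier B" if "x \<in> carrier Q.L" for x
    using that by (auto simp: localization_def loc_frac_def)
  note lift = loc_lift_frac[OF P]
  note [simp] = P.mult_notin[simplified]
  show ?thesis
  proof (rule ring_iso_memI)
    fix x assume "x \<in> carrier Q.L"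
    then show "loc_lift x \<in> carrier P.L"
      by (rule Q_carrierE) (simp add: lift)
  next
    fix x y assume "x \<in> carrier Q.L" "y \<in> carrier Q.L"
    then obtain a g b h where *: "a \<in> carrier B" "g \<in> carrier B" "g \<notin> P"
      "x = loc_frac B (P \<inter> carrier B) a g"
      "b \<in> carrier B" "h \<in> carrier B" "h \<notin> P" "y = loc_frac B (P \<inter> carrier B) b h"
      by (elim Q_carrierE)
    show "loc_lift (x \<otimes>\<^bsub>Q.L\<^esub> y) = loc_lift x \<otimes>\<^bsub>P.L\<^esub> loc_lift y"
      using * by (simp add: Q.localization_mult P.localization_mult lift e_prod)
    show "loc_lift (x \<oplus>\<^bsub>Q.L\<^esub> y) = loc_lift x \<oplus>\<^bsub>P.L\<^esub> loc_lift y"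
      using * by (simp add: Q.localization_add P.localization_add lift e_prod r_distr)
  next
    \<comment> \<open>The unit downstairs is \<open>e / e\<close>; over \<open>R\<close> the factor
      \<open>e\<close> cancels to give \<open>\<one> / \<one>\<close>.\<close>
    show "loc_lift \<one>\<^bsub>Q.L\<^esub> = \<one>\<^bsub>P.L\<^esub>"
      using P P.loc_frac_cancel[of \<one> \<one> e] P.one_notin
      by (simp add: Q.localization_one P.localization_one lift)
  next
    show "bij_betw loc_lift (carrier Q.L) (carrier P.L)"
    proof (rule bij_betwI')
      show "loc_lift x = loc_lift y \<longleftrightarrow> x = y" if "x \<in> carrier Q.L" "y \<in> carrier Q.L" for x y
        using loc_lift_inter[OF sub[OF that(1)]] loc_lift_inter[OF sub[OF that(2)]] by metis
      show "loc_lift x \<in> carrier P.L" if "x \<in> carrier Q.L" for x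
        using that by (rule Q_carrierE) (simp add: lift)
      fix y assume "y \<in> carrier P.L"
      then obtain a g where "a \<in> carrier R" "g \<in> carrier R - P" "y = loc_frac R P a g"
        by (rule P.localization_carrierE)
      then show "\<exists>x\<in>carrier Q.L. y = loc_lift x"
        using loc_frac_corner[OF P, of a g]
        by (intro bexI[of _ "loc_frac B (P \<inter> carrier B) (e \<otimes> a) (e \<otimes> g)"]) auto
    qed
  qed
qed


section \<open>Comparison of the sections\<close>

abbreviation "lift_prime Q \<equiv> {x \<in> carrier R. e \<otimes> x \<in> Q}"

definition corner_vimage :: "'a set set \<Rightarrow> 'a set set" where
  "corner_vimage V = {P \<in> D. P \<inter> carrier B \<in> V}"

text \<open>The isomorphism of localizations is applied at every point; the direction is that of
  \<open>\<phi>\<close> in \<open>isomorphic_ringed_spaces\<close>.\<close>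

definition sections_lift ::
    "'a set set \<Rightarrow> ('a set \<Rightarrow> ('a \<times> 'a) set) \<Rightarrow> 'a set \<Rightarrow> ('a \<times> 'a) set" where
  "sections_lift V s = (\<lambda>P\<in>corner_vimage V. loc_lift (s (P \<inter> carrier B)))"

lemma corner_vimageD:
  assumes "P \<in> corner_vimage V"
  shows "primeideal P R" "e \<notin> P" "P \<inter> carrier B \<in> V"
  using assms by (auto simp: corner_vimage_def)

lemma lift_prime_in_vimage:
  assumes "openin (zariski B) V" "Q \<in> V"
  shows "lift_prime Q \<in> corner_vimage V" "lift_prime Q \<inter> carrier B = Q"
  using assms primeideal_lift[of Q] corner_lift[of Q] openin_zariski_prime[OF assms]
  unfolding corner_vimage_def by simp_all

text \<open>Where \<open>s\<close> is \<open>a / g\<close> on \<open>W\<close>, the lifted section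
  is the same \<open>a / g\<close>, now over \<open>R\<close>, on the preimage of
  \<open>W\<close>.\<close>

lemma sections_lift_closed:
  assumes V: "openin (zariski B) V" and s: "s \<in> carrier (spec_sections B V)"
  shows "sections_lift V s \<in> carrier (spec_sections R (corner_vimage V))"
proof (rule spec_sectionsI)
  show "openin (zariski R) (corner_vimage V)"
    unfolding corner_vimage_def by (rule openin_corner_vimage[OF V])
  show "sections_lift V s \<in> extensional (corner_vimage V)"
    by (simp add: sections_lift_def)
  have sl: "locally_fraction B V s"
    using s by (simp add: carrier_spec_sections)
  show "locally_fraction R (corner_vimage V) (sections_lift V s)"
  proof (rule locally_fractionI)
    fix P assume P: "P \<in> corner_vimage V"
    obtain W a g where W: "openin (zariski B) W" "P \<inter> carrier B \<in> W" "W \<subseteq> V"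
      "a \<in> carrier B" "g \<in> carrier B" "\<forall>Q\<in>W. g \<notin> Q \<and> s Q = loc_frac B Q a g"
      by (rule locally_fractionE[OF sl corner_vimageD(3)[OF P]])
    have "g \<notin> Q \<and> sections_lift V s Q = loc_frac R Q a g" if Q: "Q \<in> corner_vimage W" for Q
    proof -
      note Q' = corner_vimageD[OF Q]
      have "g \<notin> Q"
        using W(5,6) Q'(3) by blast
      moreover have "Q \<in> corner_vimage V"
        using Q W(3) by (auto simp: corner_vimage_def)
      ultimately show ?thesis
        using loc_lift_frac[OF Q'(1,2) W(4,5)] W(6) Q'(3) by (simp add: sections_lift_def)
    qed
    moreover have "openin (zariski R) (corner_vimage W)"
      unfolding corner_vimage_def by (rule openin_corner_vimage[OF W(1)])
    moreover have "P \<in> corner_vimage W" "corner_vimage W \<subseteq> corner_vimage V"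
      using P W(2,3) by (auto simp: corner_vimage_def)
    ultimately have "openin (zariski R) (corner_vimage W) \<and> P \<in> corner_vimage W \<and>
        corner_vimage W \<subseteq> corner_vimage V \<and> a \<in> carrier R \<and> g \<in> carrier R \<and>
        (\<forall>Q\<in>corner_vimage W. g \<notin> Q \<and> sections_lift V s Q = loc_frac R Q a g)"
      using W(4,5) by simp
    then show "\<exists>W a g. openin (zariski R) W \<and> P \<in> W \<and> W \<subseteq> corner_vimage V \<and>
        a \<in> carrier R \<and> g \<in> carrier R \<and> (\<forall>Q\<in>W. g \<notin> Q \<and> sections_lift V s Q = loc_frac R Q a g)"
      by (intro exI)
  qed
qed

text \<open>The inverse evaluates \<open>t\<close> at the lifted prime and intersects the class with
  pairs from \<open>B\<close>; a local fraction \<open>a / g\<close> of \<open>t\<close> becomes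
  \<open>(e a) / (e g)\<close>.\<close>

lemma sections_lift_surj:
  assumes V: "openin (zariski B) V" and t: "t \<in> carrier (spec_sections R (corner_vimage V))"
  obtains s where "s \<in> carrier (spec_sections B V)" "sections_lift V s = t"
proof
  let ?s = "\<lambda>Q\<in>V. t (lift_prime Q) \<inter> carrier B \<times> carrier B"
  have tl: "locally_fraction R (corner_vimage V) t"
    using t by (simp add: carrier_spec_sections)
  show "?s \<in> carrier (spec_sections B V)"
  proof (rule spec_sectionsI[OF V])
    show "locally_fraction B V ?s"
    proof (rule locally_fractionI)
      fix Q assume Q: "Q \<in> V"
      obtain W a g where W: "openin (zariski R) W" "lift_prime Q \<in> W" "W \<subseteq> corner_vimage V"
        "a \<in> carrier R" "g \<in> carrier R" "\<forall>P\<in>W. g \<notin> P \<and> t P = loc_frac R P a g"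
        by (rule locally_fractionE[OF tl lift_prime_in_vimage(1)[OF V Q]])
      define W' where "W' = {Q. primeideal Q B \<and> lift_prime Q \<in> W}"
      have "openin (zariski B) W'"
        unfolding W'_def by (rule openin_lift_vimage[OF W(1)])
      moreover have "Q \<in> W'"
        using openin_zariski_prime[OF V Q] W(2) by (simp add: W'_def)
      \<comment> \<open>A prime of \<open>B\<close> is the contraction of its lift, and the lifts of
        members of \<open>W'\<close> lie over \<open>V\<close>.\<close>
      moreover have W'V: "W' \<subseteq> V"
      proof
        fix Q' assume "Q' \<in> W'"
        then have "lift_prime Q' \<in> corner_vimage V" "primeideal Q' B"
          using W(3) by (auto simp: W'_def)
        then show "Q' \<in> V"
          using corner_vimageD(3)[of "lift_prime Q'"] corner_lift[of Q'] by simp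
      qed
      moreover have "e \<otimes> g \<notin> Q' \<and> ?s Q' = loc_frac B Q' (e \<otimes> a) (e \<otimes> g)" if "Q' \<in> W'" for Q'
      proof -
        have Q': "primeideal Q' B" "lift_prime Q' \<in> W" "Q' \<in> V"
          using that W'V by (auto simp: W'_def)
        have g: "g \<notin> lift_prime Q'" "t (lift_prime Q') = loc_frac R (lift_prime Q') a g"
          using bspec[OF W(6) Q'(2)] by simp_all
        show ?thesis
          using loc_frac_corner(1)[OF primeideal_lift[OF Q'(1)] W(4,5) g(1)] g W(5) Q'(3)
          unfolding corner_lift[OF Q'(1)] by simp
      qed
      ultimately have "openin (zariski B) W' \<and> Q \<in> W' \<and> W' \<subseteq> V \<and> e \<otimes> a \<in> carrier B \<and>
          e \<otimes> g \<in> carrier B \<and> (\<forall>Q\<in>W'. e \<otimes> g \<notin> Q \<and> ?s Q = loc_frac B Q (e \<otimes> a) (e \<otimes> g))"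
        using W(4,5) by simp
      then show "\<exists>W a g. openin (zariski B) W \<and> Q \<in> W \<and> W \<subseteq> V \<and>
          a \<in> carrier B \<and> g \<in> carrier B \<and> (\<forall>Q\<in>W. g \<notin> Q \<and> ?s Q = loc_frac B Q a g)"
        by (intro exI)
    qed
  qed simp
  show "sections_lift V ?s = t"
  proof (rule extensionalityI[of _ "corner_vimage V"])
    show "t \<in> extensional (corner_vimage V)"
      using t by (simp add: carrier_spec_sections PiE_iff)
    fix P assume P: "P \<in> corner_vimage V"
    note P' = corner_vimageD[OF P]
    interpret P: primeideal P R by (fact P'(1))
    have "t P \<in> carrier (localization R P)"
      using P t by (auto simp: carrier_spec_sections)
    then obtain a g where "a \<in> carrier R" "g \<in> carrier R - P" "t P = loc_frac R P a g"
      by (rule P.localization_carrierE)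
    then show "sections_lift V ?s P = t P"
      using P P'(3) loc_frac_corner(3)[OF P'(1,2), of a g] lift_corner[OF P'(1,2)]
      by (simp add: sections_lift_def)
  qed (simp add: sections_lift_def)
qed

lemma sections_lift_iso:
  assumes V: "openin (zariski B) V"
  shows "sections_lift V \<in> ring_iso (spec_sections B V) (spec_sections R (corner_vimage V))"
proof (rule ring_iso_memI)
  note iso = ring_iso_memE[OF loc_lift_iso[OF corner_vimageD(1,2)]]
  have val: "s Q \<in> carrier (localization B Q)" if "s \<in> carrier (spec_sections B V)" "Q \<in> V" for s Q
    using that by (auto simp: carrier_spec_sections)
  show "sections_lift V s \<in> carrier (spec_sections R (corner_vimage V))"
    if "s \<in> carrier (spec_sections B V)" for s
    using sections_lift_closed[OF V that] .
  show "sections_lift V (s \<otimes>\<^bsub>spec_sections B V\<^esub> t) =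
      sections_lift V s \<otimes>\<^bsub>spec_sections R (corner_vimage V)\<^esub> sections_lift V t"
    and "sections_lift V (s \<oplus>\<^bsub>spec_sections B V\<^esub> t) =
      sections_lift V s \<oplus>\<^bsub>spec_sections R (corner_vimage V)\<^esub> sections_lift V t"
    if "s \<in> carrier (spec_sections B V)" "t \<in> carrier (spec_sections B V)" for s t
    using iso(2,3) val[OF that(1)] val[OF that(2)] corner_vimageD(3)
    by (auto simp: sections_lift_def fun_eq_iff)
  show "sections_lift V \<one>\<^bsub>spec_sections B V\<^esub> = \<one>\<^bsub>spec_sections R (corner_vimage V)\<^esub>"
    using iso(4) corner_vimageD(3) by (auto simp: sections_lift_def fun_eq_iff)
  show "bij_betw (sections_lift V) (carrier (spec_sections B V))
      (carrier (spec_sections R (corner_vimage V)))"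
  proof (rule bij_betwI')
    fix s t assume st: "s \<in> carrier (spec_sections B V)" "t \<in> carrier (spec_sections B V)"
    show "sections_lift V s = sections_lift V t \<longleftrightarrow> s = t"
    proof
      assume eq: "sections_lift V s = sections_lift V t"
      show "s = t"
      proof (rule extensionalityI[of _ V])
        show "s \<in> extensional V" "t \<in> extensional V"
          using st by (auto simp: carrier_spec_sections PiE_iff)
        fix Q assume Q: "Q \<in> V"
        note P = lift_prime_in_vimage[OF V Q]
        \<comment> \<open>Evaluating at \<open>lift_prime Q\<close> suffices, since that prime
          contracts to \<open>Q\<close>.\<close>
        have "loc_lift (s Q) = loc_lift (t Q)"
          using fun_cong[OF eq, of "lift_prime Q"] P by (simp add: sections_lift_def)
        moreover have "inj_on loc_lift (carrier (localization B Q))"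
          using iso(5)[OF P(1) P(1)] P(2) by (simp add: bij_betw_def)
        ultimately show "s Q = t Q"
          using val[OF st(1) Q] val[OF st(2) Q] by (simp add: inj_on_eq_iff)
      qed
    qed simp
  next
    fix t assume "t \<in> carrier (spec_sections R (corner_vimage V))"
    then show "\<exists>s\<in>carrier (spec_sections B V). t = sections_lift V s"
      using sections_lift_surj[OF V] by metis
  qed (rule sections_lift_closed[OF V])
qed

text \<open>\<open>X\<close> is described by its components because it will be an open subspace of
  the tame scheme and, for finite \<open>S\<close>, that scheme itself.\<close>

lemma isomorphic_Spec_corner:
  assumes "space X = subtopology (zariski R) D" "sections X = spec_sections R"
    "res X = (\<lambda>U V s. restrict s V)"
  shows "isomorphic_ringed_spaces X (Spec B)"
  unfolding isomorphic_ringed_spaces_def Let_def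
proof (intro exI[of _ "\<lambda>P. P \<inter> carrier B"] exI[of _ sections_lift] conjI allI impI ballI)
  show "homeomorphic_map (space X) (space (Spec B)) (\<lambda>P. P \<inter> carrier B)"
    using homeomorphic_map_corner by (simp add: assms(1) Spec_def)
  have pre: "{P \<in> topspace (space X). P \<inter> carrier B \<in> V} = corner_vimage V" for V
    by (auto simp: assms(1) topspace_zariski corner_vimage_def)
  show "sections_lift V \<in> ring_iso (sections (Spec B) V)
      (sections X {P \<in> topspace (space X). P \<inter> carrier B \<in> V})"
    if "openin (space (Spec B)) V" for V
    unfolding pre using sections_lift_iso that by (simp add: assms(2) Spec_def)
  show "sections_lift W (res (Spec B) V W s) = res X {P \<in> topspace (space X). P \<inter> carrier B \<in> V}
      {P \<in> topspace (space X). P \<inter> carrier B \<in> W} (sections_lift V s)"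
    if "W \<subseteq> V" for V W s
    unfolding pre using that
    by (auto simp: assms(3) Spec_def sections_lift_def fun_eq_iff corner_vimage_def)
qed

lemma affine_scheme_D:
  assumes "ringed_space X" "space X = subtopology (zariski R) D" "sections X = spec_sections R"
    "res X = (\<lambda>U V s. restrict s V)"
  shows "affine_scheme TYPE('a) X"
  unfolding affine_scheme_def using assms(1) cring_corner isomorphic_Spec_corner[OF assms(2-)] by blast

end

section \<open>Quasi-compactness\<close>

text \<open>The ideal generated by \<open>E\<close> is written as the directed union
  \<open>J\<close> of the ideals of its finite subsets. If \<open>J\<close> missed
  \<open>\<one>\<close>, some prime would contain \<open>J\<close> and hence
  \<open>E\<close>.\<close>

lemma (in cring) one_in_finite_genideal:
  assumes E: "E \<subseteq> carrier R" and no_prime: "\<And>P. primeideal P R \<Longrightarrow> \<not> E \<subseteq> P"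
  obtains F where "finite F" "F \<subseteq> E" "\<one> \<in> Idl F"
proof (rule ccontr)
  assume contr: "\<not> thesis"
  define J where "J = {x. \<exists>F. finite F \<and> F \<subseteq> E \<and> x \<in> Idl F}"
  have idl: "ideal (Idl F) R" if "F \<subseteq> E" for F
    using genideal_ideal that E by blast
  have "ideal J R"
  proof (rule idealI[OF ring_axioms])
    show "subgroup J (add_monoid R)"
    proof (rule add.subgroupI)
      show "J \<subseteq> carrier R"
        using ideal.Icarr[OF idl] by (auto simp: J_def)
      have "\<zero> \<in> J"
        using additive_subgroup.zero_closed[OF ideal.axioms(1)[OF idl[of "{}"]]]
        by (auto simp: J_def intro!: exI[of _ "{}"])
      then show "J \<noteq> {}"
        by blast
      show "\<ominus> x \<in> J" if "x \<in> J" for x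
        using that additive_subgroup.a_inv_closed[OF ideal.axioms(1)[OF idl]]
        by (auto simp: J_def)
      fix x y assume "x \<in> J" "y \<in> J"
      then obtain F G where FG: "finite F" "F \<subseteq> E" "x \<in> Idl F" "finite G" "G \<subseteq> E" "y \<in> Idl G"
        by (auto simp: J_def)
      have "Idl F \<subseteq> Idl (F \<union> G)" "Idl G \<subseteq> Idl (F \<union> G)"
        using FG(2,5) genideal_self[of "F \<union> G"] E by (intro genideal_minimal idl; blast)+
      then have "x \<oplus> y \<in> Idl (F \<union> G)"
        using FG idl[of "F \<union> G"] by (auto intro!: additive_subgroup.a_closed ideal.axioms(1))
      then show "x \<oplus> y \<in> J"
        using FG unfolding J_def by (auto intro!: exI[of _ "F \<union> G"])
    qed
  qed (use ideal.I_l_closed[OF idl] ideal.I_r_closed[OF idl] in \<open>auto simp: J_def\<close>)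
  moreover have "\<one> \<notin> J"
    using contr that by (auto simp: J_def)
  ultimately obtain P where P: "primeideal P R" "J \<subseteq> P"
    by (rule prime_avoiding_one)
  have "E \<subseteq> J"
  proof
    fix x assume "x \<in> E"
    then show "x \<in> J"
      using genideal_self[of "{x}"] E unfolding J_def by (auto intro!: exI[of _ "{x}"])
  qed
  then show False
    using no_prime[OF P(1)] P(2) by blast
qed

text \<open>That the \<open>U\<close> cover means that no prime contains all the sets
  \<open>E U\<close>. Hence finitely many elements of these sets generate \<open>\<one>\<close>, and
  each of them selects one member of the cover.\<close>

lemma (in cring) compact_space_zariski: "compact_space (zariski R)"
  unfolding compact_space_alt topspace_zariski
proof (intro allI impI, elim conjE)
  fix \<U> assume op: "\<forall>U\<in>\<U>. openin (zariski R) U" and cover: "{P. primeideal P R} \<subseteq> \<Union>\<U>"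
  have "\<forall>U\<in>\<U>. \<exists>E\<subseteq>carrier R. U = {P. primeideal P R \<and> \<not> E \<subseteq> P}"
    using op by (simp add: zariski_open_def)
  then obtain E where E: "\<And>U. U \<in> \<U> \<Longrightarrow> E U \<subseteq> carrier R"
      "\<And>U. U \<in> \<U> \<Longrightarrow> U = {P. primeideal P R \<and> \<not> E U \<subseteq> P}"
    by metis
  have "\<not> (\<Union>U\<in>\<U>. E U) \<subseteq> P" if P: "primeideal P R" for P
  proof -
    obtain U where U: "U \<in> \<U>" "P \<in> U"
      using cover P by blast
    then have "\<not> E U \<subseteq> P"
      using equalityD1[OF E(2)[OF U(1)]] by blast
    then show ?thesis
      using U(1) by blast
  qed
  moreover have "(\<Union>U\<in>\<U>. E U) \<subseteq> carrier R"
    using E(1) by blast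
  ultimately obtain F where F: "finite F" "F \<subseteq> (\<Union>U\<in>\<U>. E U)" "\<one> \<in> Idl F"
    using one_in_finite_genideal by metis
  then obtain K where K: "\<And>x. x \<in> F \<Longrightarrow> K x \<in> \<U> \<and> x \<in> E (K x)"
    by (metis UN_E subsetD)
  have "P \<in> \<Union>(K ` F)" if P: "primeideal P R" for P
  proof -
    interpret P: primeideal P R by fact
    \<comment> \<open>Otherwise \<open>P\<close> would contain \<open>Idl F\<close> and with it
      \<open>\<one>\<close>.\<close>
    have "\<not> F \<subseteq> P"
      using genideal_minimal[OF P.is_ideal, of F] F(3) P.one_notin by blast
    then obtain x where "x \<in> F" "x \<notin> P"
      by blast
    then have "P \<in> K x"
      using K[of x] equalityD2[OF E(2), of "K x"] P by blast
    then show ?thesis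
      using \<open>x \<in> F\<close> by blast
  qed
  then have "{P. primeideal P R} \<subseteq> \<Union>(K ` F)"
    by blast
  moreover have "finite (K ` F)" "K ` F \<subseteq> \<U>"
    using F(1) K by auto
  ultimately show "\<exists>\<F>. finite \<F> \<and> \<F> \<subseteq> \<U> \<and> {P. primeideal P R} \<subseteq> \<Union>\<F>"
    by blast
qed

text \<open>Compactness passes along the homeomorphism with a spectrum, whatever type
  \<open>'c\<close> carries the coordinate ring.\<close>

lemma affine_scheme_compact: "affine_scheme TYPE('c) X \<Longrightarrow> compact_space (space X)"
  unfolding affine_scheme_def isomorphic_ringed_spaces_def Let_def Spec_def
  using cring.compact_space_zariski homeomorphic_compact_space homeomorphic_map_imp_homeomorphic_space
  by fastforce

section \<open>Tame primes\<close>

locale ring_family =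
  fixes S :: "'i set" and R :: "'i \<Rightarrow> ('a, 'm) ring_scheme"
  assumes cring_component: "i \<in> S \<Longrightarrow> cring (R i)"
begin

lemmas component_simprules = cring.cring_simprules[OF cring_component]

abbreviation "\<R> \<equiv> prod_ring S R"

sublocale prod: cring \<R>
  by (rule cring_prod_ring) (rule cring_component)

text \<open>This embeds the factor at \<open>k\<close> as an ideal of the product. General values
  \<open>y\<close> occur because \<open>E k\<close> times \<open>x\<close> is
  \<open>single k (x k)\<close>.\<close>

definition single :: "'i \<Rightarrow> 'a \<Rightarrow> 'i \<Rightarrow> 'a" where
  "single k y = (\<lambda>i\<in>S. if i = k then y else \<zero>\<^bsub>R i\<^esub>)"

abbreviation "E k \<equiv> single k \<one>\<^bsub>R k\<^esub>"

context
  fixes k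
  assumes k: "k \<in> S"
begin

interpretation Rk: cring "R k"
  by (rule cring_component[OF k])

lemma single_apply: "single k y k = y"
  using k by (simp add: single_def)

lemma single_closed: "y \<in> carrier (R k) \<Longrightarrow> single k y \<in> carrier \<R>"
  using component_simprules(2) by (auto simp: single_def)

lemma single_zero: "single k \<zero>\<^bsub>R k\<^esub> = \<zero>\<^bsub>\<R>\<^esub>"
  by (auto simp: single_def)

lemma single_add: "single k (x \<oplus>\<^bsub>R k\<^esub> y) = single k x \<oplus>\<^bsub>\<R>\<^esub> single k y"
  using component_simprules(2,8) by (auto simp: single_def fun_eq_iff)

lemma single_mult:
  assumes "x \<in> carrier \<R>"
  shows "single k y \<otimes>\<^bsub>\<R>\<^esub> x = single k (y \<otimes>\<^bsub>R k\<^esub> x k)"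
  using assms component_simprules(26) by (auto simp: single_def fun_eq_iff PiE_iff)

lemma E_mult: "x \<in> carrier \<R> \<Longrightarrow> E k \<otimes>\<^bsub>\<R>\<^esub> x = single k (x k)"
  using k by (subst single_mult) (auto simp: PiE_iff)

lemma idempotent_E: "idempotent \<R> (E k)"
  using single_closed[of "\<one>\<^bsub>R k\<^esub>"] E_mult[of "E k"]
  by unfold_locales (simp_all add: single_apply)

lemma primeideal_component_vimage:
  assumes "primeideal p (R k)"
  shows "primeideal {x \<in> carrier \<R>. x k \<in> p} \<R>"
proof -
  interpret p: primeideal p "R k" by fact
  have "(\<lambda>x. x k) \<in> ring_hom \<R> (R k)"
    using k by (intro ring_hom_memI) (auto simp: PiE_iff)
  then show ?thesis
    using ring_hom_ring.primeideal_vimage[OF ring_hom_ringI2 prod.is_cring assms]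
      prod.ring_axioms Rk.ring_axioms by blast
qed

text \<open>\<open>single k\<close> respects sums and products but sends the unit to
  \<open>E k\<close>, so the general preimage lemma for ring homomorphisms does not apply;
  \<open>E k \<notin> P\<close> takes care of properness. For the second claim,
  \<open>x \<in> P\<close> iff \<open>E k\<close> times \<open>x\<close>, which is
  \<open>single k (x k)\<close>, lies in \<open>P\<close>.\<close>

lemma primeideal_single_vimage:
  assumes P: "primeideal P \<R>" "E k \<notin> P"
  shows "primeideal {y \<in> carrier (R k). single k y \<in> P} (R k)"
    and "P = {x \<in> carrier \<R>. x k \<in> {y \<in> carrier (R k). single k y \<in> P}}"
proof -
  interpret P: primeideal P \<R> by fact
  have mult: "single k (x \<otimes>\<^bsub>R k\<^esub> y) = single k x \<otimes>\<^bsub>\<R>\<^esub> single k y" if "y \<in> carrier (R k)" for x y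
    using single_mult[OF single_closed[OF that]] by (simp only: single_apply)
  show "primeideal {y \<in> carrier (R k). single k y \<in> P} (R k)"
  proof (rule Rk.primeidealI_closed)
    fix x y assume "x \<in> carrier (R k)" "y \<in> {y \<in> carrier (R k). single k y \<in> P}"
    then show "x \<otimes>\<^bsub>R k\<^esub> y \<in> {y \<in> carrier (R k). single k y \<in> P}"
      using P.I_l_closed[of "single k y" "single k x"] single_closed[of x]
      by (simp add: mult del: prod_ring_simps)
  next
    fix x y assume "x \<in> {y \<in> carrier (R k). single k y \<in> P}" "y \<in> {y \<in> carrier (R k). single k y \<in> P}"
    then show "x \<oplus>\<^bsub>R k\<^esub> y \<in> {y \<in> carrier (R k). single k y \<in> P}"
      using additive_subgroup.a_closed[OF P.additive_subgroup_axioms, of "single k x" "single k y"]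
      by (simp add: single_add del: prod_ring_simps)
  next
    fix x y assume "x \<in> carrier (R k)" "y \<in> carrier (R k)"
      "x \<otimes>\<^bsub>R k\<^esub> y \<in> {y \<in> carrier (R k). single k y \<in> P}"
    then show "x \<in> {y \<in> carrier (R k). single k y \<in> P} \<or> y \<in> {y \<in> carrier (R k). single k y \<in> P}"
      using P.I_prime[of "single k x" "single k y"] single_closed
      by (simp add: mult del: prod_ring_simps)
  qed (use P(2) single_zero additive_subgroup.zero_closed[OF P.additive_subgroup_axioms]
      in \<open>auto simp del: prod_ring_simps\<close>)
  have mem: "x \<in> P \<longleftrightarrow> single k (x k) \<in> P" if "x \<in> carrier \<R>" for x
    using idempotent.e_mult_mem_iff[OF idempotent_E P that] E_mult[OF that] by simp
  have "x k \<in> carrier (R k)" if "x \<in> carrier \<R>" for x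
    using that k by (auto simp: PiE_iff)
  then show "P = {x \<in> carrier \<R>. x k \<in> {y \<in> carrier (R k). single k y \<in> P}}"
    using mem P.Icarr by blast
qed

end

text \<open>The component of \<open>E k\<close> at \<open>k\<close> is the unit, which no prime
  \<open>p\<close> of \<open>R k\<close> contains. Conversely a prime avoiding \<open>E k\<close> is
  the pullback of its preimage under \<open>single k\<close>.\<close>

lemma tame_primes_eq: "tame_primes S R = {P. primeideal P \<R> \<and> (\<exists>k\<in>S. E k \<notin> P)}"
proof (intro equalityI subsetI)
  fix P assume "P \<in> tame_primes S R"
  then obtain k p where P: "primeideal P \<R>" "k \<in> S" "primeideal p (R k)"
    "P = {x \<in> carrier \<R>. x k \<in> p}"
    unfolding tame_primes_def by blast
  have "E k \<notin> P"
    using primeideal.one_notin[OF P(3)] single_apply[OF P(2)] by (simp add: P(4))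
  then show "P \<in> {P. primeideal P \<R> \<and> (\<exists>k\<in>S. E k \<notin> P)}"
    using P(1,2) by blast
next
  fix P assume "P \<in> {P. primeideal P \<R> \<and> (\<exists>k\<in>S. E k \<notin> P)}"
  then obtain k where "primeideal P \<R>" "k \<in> S" "E k \<notin> P"
    by blast
  then show "P \<in> tame_primes S R"
    unfolding tame_primes_def using primeideal_single_vimage by blast
qed

lemma openin_tame_primes: "openin (zariski \<R>) (tame_primes S R)"
proof -
  have "E ` S \<subseteq> carrier \<R>"
    using single_closed component_simprules(6) by blast
  moreover have "tame_primes S R = {P. primeideal P \<R> \<and> \<not> E ` S \<subseteq> P}"
    unfolding tame_primes_eq by blast
  ultimately show ?thesis
    unfolding openin_zariski zariski_open_def by blast
qed

lemma tame_primes_finite: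
  assumes "finite S"
  shows "tame_primes S R = {P. primeideal P \<R>}"
proof -
  have "\<exists>k\<in>S. E k \<notin> P" if "primeideal P \<R>" for P
  proof (rule ccontr)
    assume "\<not> (\<exists>k\<in>S. E k \<notin> P)"
    then have E: "E k \<in> P" if "k \<in> S" for k
      using that by blast
    interpret P: primeideal P \<R> by fact
    \<comment> \<open>\<open>c F\<close> is the sum of the \<open>E k\<close> over
      \<open>k \<in> F\<close>, given directly as an indicator function so that \<open>c S\<close>
      is visibly the unit.\<close>
    define c where "c F = (\<lambda>i\<in>S. if i \<in> F then \<one>\<^bsub>R i\<^esub> else \<zero>\<^bsub>R i\<^esub>)" for F
    have "c F \<in> P" if "finite F" "F \<subseteq> S" for F
      using that
    proof (induction F)
      case empty
      have "c {} = \<zero>\<^bsub>\<R>\<^esub>"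
        by (simp add: c_def restrict_def)
      then show ?case
        using additive_subgroup.zero_closed[OF P.additive_subgroup_axioms] by metis
    next
      case (insert k F)
      then have "E k \<oplus>\<^bsub>\<R>\<^esub> c F \<in> P"
        by (intro additive_subgroup.a_closed[OF P.additive_subgroup_axioms] E) auto
      also have "E k \<oplus>\<^bsub>\<R>\<^esub> c F = c (insert k F)"
        using insert.hyps(2) component_simprules(2,6,8,16)
        by (auto simp: single_def c_def fun_eq_iff)
      finally show ?case .
    qed
    moreover have "c S = \<one>\<^bsub>\<R>\<^esub>"
      by (auto simp: c_def fun_eq_iff)
    ultimately have "\<one>\<^bsub>\<R>\<^esub> \<in> P"
      using assms by (metis subset_refl)
    then show False
      using P.one_notin by blast
  qed
  then show ?thesis
    unfolding tame_primes_eq by blast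
qed

section \<open>The scheme of tame primes\<close>

lemma space_tame_scheme: "space (tame_scheme S R) = subtopology (zariski \<R>) (tame_primes S R)"
  and sections_tame_scheme: "sections (tame_scheme S R) = spec_sections \<R>"
  and res_tame_scheme: "res (tame_scheme S R) = (\<lambda>U V s. restrict s V)"
  by (simp_all add: tame_scheme_def open_subspace_def Spec_def)

lemma ringed_space_tame_scheme: "ringed_space (tame_scheme S R)"
  unfolding tame_scheme_def
  by (intro ringed_space_open_subspace prod.ringed_space_Spec)
    (use openin_tame_primes in \<open>simp add: Spec_def\<close>)

lemma scheme_tame_scheme: "scheme TYPE('i \<Rightarrow> 'a) (tame_scheme S R)"
  unfolding scheme_def
proof (intro conjI ballI)
  show "ringed_space (tame_scheme S R)"
    by (rule ringed_space_tame_scheme)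
  fix P assume "P \<in> topspace (space (tame_scheme S R))"
  then have "P \<in> tame_primes S R"
    by (simp add: space_tame_scheme topspace_subtopology)
  then obtain k where k: "k \<in> S" "E k \<notin> P" "primeideal P \<R>"
    unfolding tame_primes_eq by blast
  interpret idempotent \<R> "E k"
    by (rule idempotent_E[OF k(1)])
  have sub: "D \<subseteq> tame_primes S R"
    unfolding tame_primes_eq using k(1) by blast
  have op: "openin (space (tame_scheme S R)) D"
    using sub openin_D by (simp add: space_tame_scheme openin_open_subtopology[OF openin_tame_primes]
        del: openin_zariski)
  have "affine_scheme TYPE('i \<Rightarrow> 'a) (open_subspace (tame_scheme S R) D)"
  proof (rule affine_scheme_D)
    show "ringed_space (open_subspace (tame_scheme S R) D)"
      by (rule ringed_space_open_subspace[OF ringed_space_tame_scheme op])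
    show "space (open_subspace (tame_scheme S R) D) = subtopology (zariski \<R>) D"
      using sub by (simp add: open_subspace_def space_tame_scheme subtopology_subtopology Int_absorb1)
  qed (simp_all add: open_subspace_def sections_tame_scheme res_tame_scheme)
  moreover have "P \<in> D"
    using k by simp
  ultimately show "\<exists>U. openin (space (tame_scheme S R)) U \<and> P \<in> U \<and>
      affine_scheme TYPE('i \<Rightarrow> 'a) (open_subspace (tame_scheme S R) U)"
    using op by blast
qed

lemma affine_tame_scheme:
  assumes "finite S"
  shows "affine_scheme TYPE('i \<Rightarrow> 'a) (tame_scheme S R)"
proof -
  interpret idempotent \<R> "\<one>\<^bsub>\<R>\<^esub>"
    by unfold_locales (rule prod.one_closed, rule prod.l_one[OF prod.one_closed])
  have "D = tame_primes S R"
    unfolding tame_primes_finite[OF assms] using primeideal.one_notin by blast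
  then show ?thesis
    using affine_scheme_D[OF ringed_space_tame_scheme]
    by (simp add: space_tame_scheme sections_tame_scheme res_tame_scheme)
qed

lemma finite_if_compact:
  assumes compact: "compact_space (subtopology (zariski \<R>) (tame_primes S R))"
    and nonzero: "\<And>i. i \<in> S \<Longrightarrow> \<one>\<^bsub>R i\<^esub> \<noteq> \<zero>\<^bsub>R i\<^esub>"
  shows "finite S"
proof -
  define D where "D k = {P. primeideal P \<R> \<and> E k \<notin> P}" for k
  have tame: "tame_primes S R = (\<Union>k\<in>S. D k)"
    unfolding tame_primes_eq D_def by blast
  have "openin (subtopology (zariski \<R>) (tame_primes S R)) (D k)" if "k \<in> S" for k
  proof -
    have "D k \<subseteq> tame_primes S R"
      unfolding tame using that by blast
    then show ?thesis
      using idempotent.openin_D[OF idempotent_E[OF that]]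
      by (simp add: openin_open_subtopology[OF openin_tame_primes] D_def del: openin_zariski)
  qed
  moreover have "topspace (subtopology (zariski \<R>) (tame_primes S R)) = \<Union>(D ` S)"
    using openin_subset[OF openin_tame_primes] by (simp add: tame topspace_subtopology Int_absorb1)
  ultimately obtain \<F> where \<F>: "finite \<F>" "\<F> \<subseteq> D ` S" "tame_primes S R \<subseteq> \<Union>\<F>"
    using compact unfolding compact_space_alt tame
    by (metis (no_types, lifting) image_iff subset_refl)
  then obtain T where T: "T \<subseteq> S" "finite T" "\<F> = D ` T"
    by (meson finite_subset_image)
  have "k \<in> T" if k: "k \<in> S" for k
  proof -
    interpret Rk: cring "R k"
      by (rule cring_component[OF k])
    \<comment> \<open>The factor being nonzero makes its zero ideal proper, which provides a prime
      \<open>p\<close>.\<close>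
    have "\<one>\<^bsub>R k\<^esub> \<notin> {\<zero>\<^bsub>R k\<^esub>}"
      using nonzero[OF k] by simp
    then obtain p where p: "primeideal p (R k)"
      using Rk.prime_avoiding_one[OF Rk.zeroideal] by blast
    \<comment> \<open>This prime lies in \<open>D k\<close> only: for \<open>j \<noteq> k\<close>
      the component of \<open>E j\<close> at \<open>k\<close> is zero and hence belongs to
      \<open>p\<close>.\<close>
    define P where "P = {x \<in> carrier \<R>. x k \<in> p}"
    interpret P: primeideal P \<R>
      unfolding P_def by (rule primeideal_component_vimage[OF k p])
    have "E k \<notin> P"
      using primeideal.one_notin[OF p] single_apply[OF k] by (simp add: P_def)
    then have "P \<in> tame_primes S R"
      unfolding tame D_def using P.primeideal k by blast
    then obtain j where j: "j \<in> T" "E j \<notin> P"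
      using \<F>(3) T(3) unfolding D_def by blast
    have jS: "j \<in> S"
      using j(1) T(1) by blast
    have "E j \<in> carrier \<R>" 
      by (rule single_closed[OF jS component_simprules(6)[OF jS]])
    moreover have "E j k = \<zero>\<^bsub>R k\<^esub>" if "j \<noteq> k"
      using that k by (simp add: single_def)
    ultimately have "j = k"
      using j(2) additive_subgroup.zero_closed[OF ideal.axioms(1)[OF primeideal.axioms(1)[OF p]]]
      by (cases "j = k") (auto simp: P_def)
    then show ?thesis
      using j(1) by simp
  qed
  then have "S \<subseteq> T"
    by blast
  then show ?thesis
    using T(2) by (rule finite_subset)
qed

end

theorem theorem2p2:
  fixes S :: "'i set" and R :: "'i \<Rightarrow> ('a, 'm) ring_scheme"
  assumes "\<And>i. i \<in> S \<Longrightarrow> cring (R i)"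
    and "\<And>i. i \<in> S \<Longrightarrow> \<one>\<^bsub>R i\<^esub> \<noteq> \<zero>\<^bsub>R i\<^esub>"
  shows "openin (space (Spec (prod_ring S R))) (tame_primes S R) \<and>
    scheme TYPE('i \<Rightarrow> 'a) (tame_scheme S R) \<and>
    (affine_scheme TYPE('i \<Rightarrow> 'a) (tame_scheme S R) \<longleftrightarrow> finite S) \<and>
    (affine_scheme TYPE('c) (tame_scheme S R) \<longrightarrow> finite S)"
proof -
  interpret ring_family S R
    using assms(1) by (rule ring_family.intro)
  \<comment> \<open>Phrased through compactness, this serves both coordinate types,
    \<open>'i \<Rightarrow> 'a\<close> and \<open>'c\<close>.\<close>
  have "finite S" if "compact_space (space (tame_scheme S R))"
    using that finite_if_compact assms(2) by (simp add: space_tame_scheme)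
  then show ?thesis
    using openin_tame_primes scheme_tame_scheme affine_tame_scheme
      affine_scheme_compact[where 'c = 'c] affine_scheme_compact[where 'c = "'i \<Rightarrow> 'a"]
    by (auto simp: Spec_def)
qed

end
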